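(* (1) Let $m\in\mathbb{Z}_+$ and suppose $V$ is a simple $F_{[m]}$-module such that $z$ acts on $V$ as a scalar $\lambda\in\mathbb{C}^*$. Then $V\cong\mathscr{V}_{[m]}^{\sqrt\lambda}$ for some $\sqrt\lambda\in\mathbb{C}$ with $(\sqrt\lambda)^2=\lambda$. (2) Suppose $V$ is a simple smooth $F$-module such that $z$ acts on $V$ as a scalar $\lambda\in\mathbb{C}^*$. Then $V\cong\mathscr{V}^{\sqrt\lambda}$ for some $\sqrt\lambda\in\mathbb{C}$ with $(\sqrt\lambda)^2=\lambda$.
   Context: All vector spaces and algebras are over $\mathbb{C}$; $\mathbb{Z}_+$ is the set of non-negative integers, $\mathbb{N}$ the set of positive integers, $\mathbb{C}^*$ the nonzero complex numbers. Modules over Lie superalgebras are $\mathbb{Z}_2$-graded, and simple means having no nonzero proper graded submodule. The Fermion algebra $F=F(0)$ is the Lie superalgebra with basis $\{\psi_m, z: m\in\mathbb{Z}\}$, the $\psi_m$ odd and $z$ even, with $[\psi_m,\psi_n]=\delta_{m,-n}z$ and $[F,z]=0$. For $m\in\mathbb{Z}_+$, $F_{[m]}=\bigoplus_{i=-m}^m\mathbb{C}\psi_i\oplus\mathbb{C}z$ is a subalgebra of $F$. An $F$-module $V$ is smooth if for every $v\in V$ there is $n\in\mathbb{Z}_+$ with $\psi_iv=0$ for all $i>n$. $\mathscr{V}$ is the exterior algebra generated by odd elements $\xi_i$, $i\in\mathbb{Z}_+$, with basis $1$, $\xi_{i_1}\cdots\xi_{i_k}$ ($0\le i_1<\dots<i_k$,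 $k\in\mathbb{N}$), with $F$-module structure: for $n\in\mathbb{N}$, $\psi_n$ acts as the odd derivation $\partial/\partial\xi_n$, $\psi_{-n}$ acts as left multiplication by $\xi_n$, $\psi_0$ acts as $\frac1{\sqrt2}(\xi_0+\partial/\partial\xi_0)$, and $z$ acts as the identity. For $m\in\mathbb{Z}_+$, $\mathscr{V}_{[m]}$ is the $F_{[m]}$-submodule of $\mathscr{V}$ spanned by $1$ and all $\xi_{i_1}\cdots\xi_{i_k}$ with $0\le i_1<\dots<i_k\le m$. For $\mathfrak g=F$ or $F_{[m]}$ and $\mu\in\mathbb{C}^*$, let $\sigma_\mu$ be the automorphism of $\mathfrak g$ with $\sigma_\mu(\psi_l)=\mu\psi_l$, $\sigma_\mu(z)=\mu^2z$. For a $\mathfrak g$-module $V$, $V^\mu$ denotes the $\mathfrak g$-module with the same underlying space and action $x\cdot v=\sigma_\mu(x)v$. *)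

theory Defs
  imports
    Complex_Main
    "HOL-Library.Poly_Mapping"
    "HOL-Library.FSet"
    "HOL-Library.Z2"
begin

section \<open>Lie superalgebras and their graded modules\<close>

text \<open>
  A $\mathbb{Z}_2$-graded complex vector space is given by its two homogeneous parts
  \<^term>\<open>V 0\<close> and \<^term>\<open>V 1\<close>, independent subspaces of an ambient complex vector space;
  the graded space itself is their sum.  The degrees are elements of the two-element field
  \<^typ>\<open>bit\<close>, in which 1 + 1 = 0.
\<close>

definition total_space :: "(bit \<Rightarrow> 'v::ab_group_add set) \<Rightarrow> 'v set"
  where "total_space V = {a + b | a b. a \<in> V 0 \<and> b \<in> V 1}"

locale super_space = vector_space scale
  for scale :: "complex \<Rightarrow> 'v::ab_group_add \<Rightarrow> 'v" +
  fixes V :: "bit \<Rightarrow> 'v set"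
  assumes subspace_part: "subspace (V i)"
    and parts_independent: "V 0 \<inter> V 1 = {0}"

definition koszul :: "bit \<Rightarrow> bit \<Rightarrow> complex"
  where "koszul i j = (if i = 1 \<and> j = 1 then -1 else 1)"

text \<open>
  The bracket (and below the action) is a function on the ambient type; only its values on the
  graded spaces matter.
\<close>

locale lie_superalgebra = super_space sG G
  for sG :: "complex \<Rightarrow> 'g::ab_group_add \<Rightarrow> 'g" and G :: "bit \<Rightarrow> 'g set" +
  fixes br :: "'g \<Rightarrow> 'g \<Rightarrow> 'g"
  assumes br_add_left: "\<lbrakk>x \<in> total_space G; x' \<in> total_space G; y \<in> total_space G\<rbrakk> \<Longrightarrow> br (x + x') y = br x y + br x' y"
    and br_add_right: "\<lbrakk>x \<in> total_space G; y \<in> total_space G; y' \<in> total_space G\<rbrakk> \<Longrightarrow> br x (y + y') = br x y + br x y'"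
    and br_scale_left: "\<lbrakk>x \<in> total_space G; y \<in> total_space G\<rbrakk> \<Longrightarrow> br (sG c x) y = sG c (br x y)"
    and br_scale_right: "\<lbrakk>x \<in> total_space G; y \<in> total_space G\<rbrakk> \<Longrightarrow> br x (sG c y) = sG c (br x y)"
    and br_graded: "\<lbrakk>x \<in> G i; y \<in> G j\<rbrakk> \<Longrightarrow> br x y \<in> G (i + j)"
    and br_skew: "\<lbrakk>x \<in> G i; y \<in> G j\<rbrakk> \<Longrightarrow> br x y = - sG (koszul i j) (br y x)"
    and br_jacobi: "\<lbrakk>x \<in> G i; y \<in> G j; w \<in> G k\<rbrakk> \<Longrightarrow>
      br x (br y w) = br (br x y) w + sG (koszul i j) (br y (br x w))"

locale lie_supermodule = lie_superalgebra sG G br + M: super_space sV V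
  for sG :: "complex \<Rightarrow> 'g::ab_group_add \<Rightarrow> 'g" and G :: "bit \<Rightarrow> 'g set"
    and br :: "'g \<Rightarrow> 'g \<Rightarrow> 'g"
    and sV :: "complex \<Rightarrow> 'v::ab_group_add \<Rightarrow> 'v" and V :: "bit \<Rightarrow> 'v set" +
  fixes act :: "'g \<Rightarrow> 'v \<Rightarrow> 'v"
  assumes act_add_left: "\<lbrakk>x \<in> total_space G; y \<in> total_space G; v \<in> total_space V\<rbrakk> \<Longrightarrow> act (x + y) v = act x v + act y v"
    and act_add_right: "\<lbrakk>x \<in> total_space G; v \<in> total_space V; w \<in> total_space V\<rbrakk> \<Longrightarrow> act x (v + w) = act x v + act x w"
    and act_scale_left: "\<lbrakk>x \<in> total_space G; v \<in> total_space V\<rbrakk> \<Longrightarrow> act (sG c x) v = sV c (act x v)"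
    and act_scale_right: "\<lbrakk>x \<in> total_space G; v \<in> total_space V\<rbrakk> \<Longrightarrow> act x (sV c v) = sV c (act x v)"
    and act_graded: "\<lbrakk>x \<in> G i; v \<in> V j\<rbrakk> \<Longrightarrow> act x v \<in> V (i + j)"
    and act_br: "\<lbrakk>x \<in> G i; y \<in> G j; v \<in> total_space V\<rbrakk> \<Longrightarrow>
      act (br x y) v = act x (act y v) - sV (koszul i j) (act y (act x v))"
begin

definition graded_submodule :: "'v set \<Rightarrow> bool"
  where "graded_submodule W \<longleftrightarrow>
    M.subspace W \<and> W = total_space (\<lambda>i. W \<inter> V i) \<and> (\<forall>x\<in>total_space G. \<forall>w\<in>W. act x w \<in> W)"

end

locale simple_lie_supermodule = lie_supermodule +
  assumes nonzero: "total_space V \<noteq> {0}"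
    and simple: "graded_submodule W \<Longrightarrow> W = {0} \<or> W = total_space V"

text \<open>Isomorphisms are understood to be even, i.e. to preserve degrees.\<close>

definition supermodule_isomorphic ::
  "(bit \<Rightarrow> 'g::ab_group_add set) \<Rightarrow>
   (complex \<Rightarrow> 'v::ab_group_add \<Rightarrow> 'v) \<Rightarrow> (bit \<Rightarrow> 'v set) \<Rightarrow> ('g \<Rightarrow> 'v \<Rightarrow> 'v) \<Rightarrow>
   (complex \<Rightarrow> 'w::ab_group_add \<Rightarrow> 'w) \<Rightarrow> (bit \<Rightarrow> 'w set) \<Rightarrow> ('g \<Rightarrow> 'w \<Rightarrow> 'w) \<Rightarrow> bool"
  where "supermodule_isomorphic G sV V actV sW W actW \<longleftrightarrow>
    (\<exists>f. bij_betw f (total_space V) (total_space W)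
       \<and> (\<forall>v\<in>total_space V. \<forall>v'\<in>total_space V. f (v + v') = f v + f v')
       \<and> (\<forall>c. \<forall>v\<in>total_space V. f (sV c v) = sW c (f v))
       \<and> (\<forall>i. f ` V i \<subseteq> W i)
       \<and> (\<forall>x\<in>total_space G. \<forall>v\<in>total_space V. f (actV x v) = actW x (f v)))"


section \<open>Complex vector spaces with a given basis\<close>

text \<open>
  \<^typ>\<open>'b \<Rightarrow>\<^sub>0 complex\<close> is the complex vector space with basis \<^term>\<open>basis b\<close>, for \<open>b :: 'b\<close>.
\<close>

lift_definition pscale :: "complex \<Rightarrow> ('b \<Rightarrow>\<^sub>0 complex) \<Rightarrow> ('b \<Rightarrow>\<^sub>0 complex)"
  is "\<lambda>c f b. c * f b"
  by (rule finite_subset) auto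

abbreviation basis :: "'b \<Rightarrow> ('b \<Rightarrow>\<^sub>0 complex)"
  where "basis b \<equiv> Poly_Mapping.single b 1"

definition lin_ext :: "('b \<Rightarrow> ('c \<Rightarrow>\<^sub>0 complex)) \<Rightarrow> ('b \<Rightarrow>\<^sub>0 complex) \<Rightarrow> ('c \<Rightarrow>\<^sub>0 complex)"
  where "lin_ext f x = (\<Sum>b\<in>Poly_Mapping.keys x. pscale (Poly_Mapping.lookup x b) (f b))"

definition basis_span :: "'b set \<Rightarrow> ('b \<Rightarrow>\<^sub>0 complex) set"
  where "basis_span A = {x. Poly_Mapping.keys x \<subseteq> A}"

lemma lookup_pscale [simp]: "Poly_Mapping.lookup (pscale c x) b = c * Poly_Mapping.lookup x b"
  by transfer simp

interpretation pm: vector_space pscale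
  by standard (auto intro!: poly_mapping_eqI simp: lookup_add algebra_simps)

lemma lin_ext_superset:
  assumes "finite A" "Poly_Mapping.keys x \<subseteq> A"
  shows "lin_ext f x = (\<Sum>b\<in>A. pscale (Poly_Mapping.lookup x b) (f b))"
  unfolding lin_ext_def
  by (rule sum.mono_neutral_left) (use assms in \<open>auto simp: in_keys_iff\<close>)

lemma lin_ext_add: "lin_ext f (x + y) = lin_ext f x + lin_ext f y"
proof -
  let ?A = "Poly_Mapping.keys x \<union> Poly_Mapping.keys y"
  have "lin_ext f (x + y) = (\<Sum>b\<in>?A. pscale (Poly_Mapping.lookup (x + y) b) (f b))"
    by (rule lin_ext_superset) (auto simp: Poly_Mapping.keys_add)
  also have "\<dots> = (\<Sum>b\<in>?A. pscale (Poly_Mapping.lookup x b) (f b)) + (\<Sum>b\<in>?A. pscale (Poly_Mapping.lookup y b) (f b))"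
    by (simp add: lookup_add pm.scale_left_distrib sum.distrib)
  also have "\<dots> = lin_ext f x + lin_ext f y"
    by (simp add: lin_ext_superset[of ?A])
  finally show ?thesis .
qed

lemma lin_ext_scale: "lin_ext f (pscale c x) = pscale c (lin_ext f x)"
proof -
  have "lin_ext f (pscale c x) = (\<Sum>b\<in>Poly_Mapping.keys x. pscale (Poly_Mapping.lookup (pscale c x) b) (f b))"
    by (rule lin_ext_superset) (auto simp: in_keys_iff)
  also have "\<dots> = pscale c (lin_ext f x)"
    unfolding lin_ext_def by (simp add: pm.scale_sum_right)
  finally show ?thesis .
qed

lemma linear_lin_ext: "Vector_Spaces.linear pscale pscale (lin_ext f)"
  by unfold_locales (simp_all add: lin_ext_add lin_ext_scale)

lemma lin_ext_zero [simp]: "lin_ext f 0 = 0"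
  by (simp add: lin_ext_def)

lemma lin_ext_fun_add: "lin_ext (\<lambda>b. f b + g b) x = lin_ext f x + lin_ext g x"
  by (simp add: lin_ext_def pm.scale_right_distrib sum.distrib)

lemma lin_ext_fun_scale: "lin_ext (\<lambda>b. pscale c (f b)) x = pscale c (lin_ext f x)"
  by (simp add: lin_ext_def pm.scale_sum_right mult.commute)

lemma lin_ext_fun_zero [simp]: "lin_ext (\<lambda>b. 0) x = 0"
  by (simp add: lin_ext_def)

lemma lin_ext_mem:
  assumes "pm.subspace W" "x \<in> basis_span A" "\<And>b. b \<in> A \<Longrightarrow> f b \<in> W"
  shows "lin_ext f x \<in> W"
  unfolding lin_ext_def
  by (rule pm.subspace_sum) (use assms in \<open>auto simp: basis_span_def intro!: pm.subspace_scale\<close>)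

lemma lin_ext_basis [simp]: "lin_ext f (basis b) = f b"
  by (simp add: lin_ext_def)

lemma pm_decomp: "x = (\<Sum>b\<in>Poly_Mapping.keys x. pscale (Poly_Mapping.lookup x b) (basis b))"
proof (rule poly_mapping_eqI)
  fix k
  have "Poly_Mapping.lookup (\<Sum>b\<in>Poly_Mapping.keys x. pscale (Poly_Mapping.lookup x b) (basis b)) k
     = (\<Sum>b\<in>Poly_Mapping.keys x. if b = k then Poly_Mapping.lookup x b else 0)"
    unfolding lookup_sum by (rule sum.cong) (auto simp: lookup_single when_def)
  also have "\<dots> = Poly_Mapping.lookup x k"
    by (auto simp: in_keys_iff)
  finally show "Poly_Mapping.lookup x k
     = Poly_Mapping.lookup (\<Sum>b\<in>Poly_Mapping.keys x. pscale (Poly_Mapping.lookup x b) (basis b)) k" by simp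
qed

lemma basis_span_eq_span: "basis_span A = pm.span (basis ` A)"
proof (intro equalityI subsetI)
  fix x assume "x \<in> basis_span A"
  then have "\<And>b. b \<in> Poly_Mapping.keys x \<Longrightarrow> b \<in> A" by (auto simp: basis_span_def)
  then show "x \<in> pm.span (basis ` A)"
    by (subst pm_decomp) (intro pm.span_sum pm.span_scale pm.span_base imageI)
next
  fix x assume "x \<in> pm.span (basis ` A)"
  moreover have "pm.subspace (basis_span A)"
    by (auto simp: pm.subspace_def basis_span_def subset_iff in_keys_iff lookup_add)
      (metis add.right_neutral)
  moreover have "basis ` A \<subseteq> basis_span A" by (auto simp: basis_span_def)
  ultimately show "x \<in> basis_span A"
    using pm.span_minimal by blast
qed

lemma subspace_basis_span: "pm.subspace (basis_span A)"
  by (simp add: basis_span_eq_span)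

lemma basis_span_induct [consumes 1, case_names zero add scale basis]:
  assumes "x \<in> basis_span A" "P 0" "\<And>x y. P x \<Longrightarrow> P y \<Longrightarrow> P (x + y)"
    "\<And>c x. P x \<Longrightarrow> P (pscale c x)" "\<And>b. b \<in> A \<Longrightarrow> P (basis b)"
  shows "P x"
proof -
  have "pm.span (basis ` A) \<subseteq> Collect P"
    by (rule pm.span_minimal) (use assms(2-) in \<open>auto simp: pm.subspace_def\<close>)
  then show ?thesis using assms(1) by (auto simp: basis_span_eq_span)
qed

lemma basis_span_UNIV: "x \<in> basis_span UNIV"
  by (simp add: basis_span_def)

lemma total_space_basis_span:
  "total_space (\<lambda>i. basis_span {b \<in> A. d b = i}) = basis_span A"
proof -
  have "total_space (\<lambda>i. basis_span {b \<in> A. d b = i})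
      = pm.span (basis ` {b \<in> A. d b = 0} \<union> basis ` {b \<in> A. d b = 1})"
    unfolding total_space_def basis_span_eq_span pm.span_Un by auto
  also have "basis ` {b \<in> A. d b = 0} \<union> basis ` {b \<in> A. d b = 1} = basis ` A"
  proof -
    have "{b \<in> A. d b = 0} \<union> {b \<in> A. d b = 1} = A" using bit_not_zero_iff by blast
    then show ?thesis by (simp flip: image_Un)
  qed
  finally show ?thesis by (simp add: basis_span_eq_span)
qed

lemma super_space_basis_span: "super_space pscale (\<lambda>i. basis_span {b \<in> A. d b = i})"
proof
  show "basis_span {b \<in> A. d b = 0} \<inter> basis_span {b \<in> A. d b = 1} = {0}"
    by (auto simp: basis_span_def poly_mapping_eq_iff fun_eq_iff in_keys_iff subset_iff)
qed (rule subspace_basis_span)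


section \<open>The Fermion algebra\<close>

datatype fermion_index = Psi int | Zc

type_synonym fermion = "fermion_index \<Rightarrow>\<^sub>0 complex"

abbreviation psi :: "int \<Rightarrow> fermion"
  where "psi n \<equiv> basis (Psi n)"

abbreviation fermion_z :: fermion
  where "fermion_z \<equiv> basis Zc"

fun fermion_deg :: "fermion_index \<Rightarrow> bit"
  where
    "fermion_deg (Psi n) = 1"
  | "fermion_deg Zc = 0"

fun fermion_basis_br :: "fermion_index \<Rightarrow> fermion_index \<Rightarrow> fermion"
  where
    "fermion_basis_br (Psi m) (Psi n) = (if m = - n then fermion_z else 0)"
  | "fermion_basis_br Zc b = 0"
  | "fermion_basis_br a Zc = 0"

definition fermion_br :: "fermion \<Rightarrow> fermion \<Rightarrow> fermion"
  where "fermion_br x y = lin_ext (\<lambda>a. lin_ext (fermion_basis_br a) y) x"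

definition fermion_part :: "bit \<Rightarrow> fermion set"
  where "fermion_part i = basis_span {b. fermion_deg b = i}"

definition fermion_trunc_part :: "nat \<Rightarrow> bit \<Rightarrow> fermion set"
  where "fermion_trunc_part m i =
    basis_span {b \<in> insert Zc (Psi ` {- int m .. int m}). fermion_deg b = i}"

lemma fermion_br_add_left: "fermion_br (x + x') y = fermion_br x y + fermion_br x' y"
  by (simp add: fermion_br_def lin_ext_add)

lemma fermion_br_add_right: "fermion_br x (y + y') = fermion_br x y + fermion_br x y'"
  by (simp add: fermion_br_def lin_ext_add lin_ext_fun_add)

lemma fermion_br_scale_left: "fermion_br (pscale c x) y = pscale c (fermion_br x y)"
  by (simp add: fermion_br_def lin_ext_scale)

lemma fermion_br_scale_right: "fermion_br x (pscale c y) = pscale c (fermion_br x y)"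
  by (simp add: fermion_br_def lin_ext_scale lin_ext_fun_scale)

lemma fermion_br_zero [simp]: "fermion_br 0 y = 0" "fermion_br x 0 = 0"
  by (simp_all add: fermion_br_def)

lemma fermion_br_basis [simp]: "fermion_br (basis a) (basis b) = fermion_basis_br a b"
  by (simp add: fermion_br_def)

lemma fermion_br_psi: "fermion_br (psi m) (psi n) = (if m = - n then fermion_z else 0)"
  by simp

lemmas fermion_br_linear =
  fermion_br_add_left fermion_br_add_right fermion_br_scale_left fermion_br_scale_right

lemma fermion_br_mem:
  assumes "x \<in> basis_span A" "y \<in> basis_span B" "pm.subspace W"
    "\<And>a b. a \<in> A \<Longrightarrow> b \<in> B \<Longrightarrow> fermion_basis_br a b \<in> W"
  shows "fermion_br x y \<in> W"
  unfolding fermion_br_def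
  by (rule lin_ext_mem[OF assms(3,1)], rule lin_ext_mem[OF assms(3,2)]) (rule assms(4))

lemma fermion_br_in_center: "fermion_br x y \<in> basis_span {Zc}"
proof (rule fermion_br_mem[OF basis_span_UNIV basis_span_UNIV subspace_basis_span])
  fix a b show "fermion_basis_br a b \<in> basis_span {Zc}"
    by (cases a; cases b) (auto simp: basis_span_def)
qed

lemma fermion_br_center:
  assumes "w \<in> basis_span {Zc}"
  shows "fermion_br x w = 0" "fermion_br w x = 0"
proof -
  have "fermion_br x w \<in> {0}"
    by (rule fermion_br_mem[OF basis_span_UNIV assms]) (auto, metis fermion_basis_br.simps(2,3) fermion_index.exhaust)
  then show "fermion_br x w = 0" by simp
  have "fermion_br w x \<in> {0}"
    by (rule fermion_br_mem[OF assms basis_span_UNIV]) auto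
  then show "fermion_br w x = 0" by simp
qed

lemma fermion_br_skew:
  assumes "x \<in> basis_span {b \<in> A. fermion_deg b = i}" "y \<in> basis_span {b \<in> B. fermion_deg b = j}"
  shows "fermion_br x y = - pscale (koszul i j) (fermion_br y x)"
  using assms(1)
proof (induction rule: basis_span_induct)
  case (basis a)
  show ?case using assms(2)
  proof (induction rule: basis_span_induct)
    case b: (basis b)
    show ?case using basis b
      by (cases a; cases b) (auto simp: koszul_def)
  qed (simp_all add: fermion_br_linear pm.scale_right_distrib mult.commute)
qed (simp_all add: fermion_br_linear pm.scale_right_distrib mult.commute)

lemma lie_superalgebra_fermion_on:
  assumes "Zc \<in> A"
  shows "lie_superalgebra pscale (\<lambda>i. basis_span {b \<in> A. fermion_deg b = i}) fermion_br"
proof (intro lie_superalgebra.intro super_space_basis_span lie_superalgebra_axioms.intro)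
  fix x y i j assume "x \<in> basis_span {b \<in> A. fermion_deg b = i}" "y \<in> basis_span {b \<in> A. fermion_deg b = j}"
  then show "fermion_br x y \<in> basis_span {b \<in> A. fermion_deg b = i + j}"
  proof (rule fermion_br_mem[OF _ _ subspace_basis_span])
    fix a b assume "a \<in> {b \<in> A. fermion_deg b = i}" "b \<in> {b \<in> A. fermion_deg b = j}"
    then show "fermion_basis_br a b \<in> basis_span {b \<in> A. fermion_deg b = i + j}"
      using assms by (cases a; cases b) (auto simp: basis_span_def)
  qed
qed (rule fermion_br_skew | simp add: fermion_br_linear fermion_br_center fermion_br_in_center)+

theorem lie_superalgebra_fermion: "lie_superalgebra pscale fermion_part fermion_br"
  using lie_superalgebra_fermion_on[of UNIV] by (simp add: fermion_part_def[abs_def])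

theorem lie_superalgebra_fermion_trunc: "lie_superalgebra pscale (fermion_trunc_part m) fermion_br"
  unfolding fermion_trunc_part_def[abs_def] by (rule lie_superalgebra_fermion_on) simp

text \<open>The automorphism \<open>\<sigma>\<^sub>\<mu>\<close> and the twisted module \<open>V\<^sup>\<mu>\<close> (same space, twisted action).\<close>

definition fermion_sigma :: "complex \<Rightarrow> fermion \<Rightarrow> fermion"
  where "fermion_sigma \<mu> =
    lin_ext (\<lambda>b. case b of Psi l \<Rightarrow> pscale \<mu> (psi l) | Zc \<Rightarrow> pscale (\<mu>\<^sup>2) fermion_z)"

definition twist :: "complex \<Rightarrow> (fermion \<Rightarrow> 'v \<Rightarrow> 'v) \<Rightarrow> fermion \<Rightarrow> 'v \<Rightarrow> 'v"
  where "twist \<mu> act x v = act (fermion_sigma \<mu> x) v"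

lemma fermion_sigma_linear:
  "fermion_sigma \<mu> (x + y) = fermion_sigma \<mu> x + fermion_sigma \<mu> y"
  "fermion_sigma \<mu> (pscale c x) = pscale c (fermion_sigma \<mu> x)"
  by (simp_all add: fermion_sigma_def lin_ext_add lin_ext_scale)

lemma fermion_sigma_basis [simp]:
  "fermion_sigma \<mu> (psi l) = pscale \<mu> (psi l)"
  "fermion_sigma \<mu> fermion_z = pscale (\<mu>\<^sup>2) fermion_z"
  by (simp_all add: fermion_sigma_def)

lemma fermion_sigma_zero [simp]: "fermion_sigma \<mu> 0 = 0"
  by (simp add: fermion_sigma_def)

lemma fermion_sigma_br: "fermion_sigma \<mu> (fermion_br x y) = fermion_br (fermion_sigma \<mu> x) (fermion_sigma \<mu> y)"
  using basis_span_UNIV[of x]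
proof (induction rule: basis_span_induct)
  case (basis a)
  show ?case using basis_span_UNIV[of y]
  proof (induction rule: basis_span_induct)
    case (basis b)
    show ?case
      by (cases a; cases b) (auto simp: fermion_br_linear power2_eq_square)
  qed (simp_all add: fermion_br_linear fermion_sigma_linear)
qed (simp_all add: fermion_br_linear fermion_sigma_linear)

lemma fermion_sigma_inverse:
  assumes "\<mu> \<noteq> 0"
  shows "fermion_sigma \<mu> (fermion_sigma (inverse \<mu>) x) = x"
  using basis_span_UNIV[of x]
proof (induction rule: basis_span_induct)
  case (basis a)
  show ?case using assms by (cases a) (simp_all add: fermion_sigma_linear power_inverse)
qed (simp_all add: fermion_sigma_linear)

lemma bij_fermion_sigma:
  assumes "\<mu> \<noteq> 0"
  shows "bij (fermion_sigma \<mu>)"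
proof (rule o_bij)
  show "fermion_sigma \<mu> \<circ> fermion_sigma (inverse \<mu>) = id"
    using assms by (auto simp: fermion_sigma_inverse)
  show "fermion_sigma (inverse \<mu>) \<circ> fermion_sigma \<mu> = id"
    using fermion_sigma_inverse[of "inverse \<mu>"] assms by auto
qed

lemma fermion_sigma_mem:
  assumes "x \<in> basis_span A"
  shows "fermion_sigma \<mu> x \<in> basis_span A"
  unfolding fermion_sigma_def
proof (rule lin_ext_mem[OF subspace_basis_span assms])
  fix b assume "b \<in> A"
  then show "(case b of Psi l \<Rightarrow> pscale \<mu> (psi l) | Zc \<Rightarrow> pscale (\<mu>\<^sup>2) fermion_z) \<in> basis_span A"
    by (cases b) (auto simp: basis_span_def in_keys_iff lookup_single when_def split: if_splits)
qed

lemma lie_supermodule_twist_on: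
  assumes "lie_supermodule pscale (\<lambda>i. basis_span {b \<in> A. fermion_deg b = i}) fermion_br sV V act"
  shows "lie_supermodule pscale (\<lambda>i. basis_span {b \<in> A. fermion_deg b = i}) fermion_br sV V (twist \<mu> act)"
proof -
  interpret lie_supermodule pscale "\<lambda>i. basis_span {b \<in> A. fermion_deg b = i}" fermion_br sV V act
    by (rule assms)
  show ?thesis
    by unfold_locales
      (simp_all only: twist_def fermion_sigma_linear fermion_sigma_br total_space_basis_span fermion_sigma_mem
        act_add_left[unfolded total_space_basis_span] act_add_right[unfolded total_space_basis_span]
        act_scale_left[unfolded total_space_basis_span] act_scale_right[unfolded total_space_basis_span]
        act_graded act_br)
qed

theorem lie_supermodule_twist:
  "lie_supermodule pscale fermion_part fermion_br sV V act \<Longrightarrow>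
   lie_supermodule pscale fermion_part fermion_br sV V (twist \<mu> act)"
  using lie_supermodule_twist_on[of UNIV] by (simp add: fermion_part_def[abs_def])

theorem lie_supermodule_twist_trunc:
  "lie_supermodule pscale (fermion_trunc_part m) fermion_br sV V act \<Longrightarrow>
   lie_supermodule pscale (fermion_trunc_part m) fermion_br sV V (twist \<mu> act)"
  unfolding fermion_trunc_part_def[abs_def] by (rule lie_supermodule_twist_on)

definition smooth_module :: "(bit \<Rightarrow> 'v::ab_group_add set) \<Rightarrow> (fermion \<Rightarrow> 'v \<Rightarrow> 'v) \<Rightarrow> bool"
  where "smooth_module V act \<longleftrightarrow> (\<forall>v\<in>total_space V. \<exists>n::nat. \<forall>i>int n. act (psi i) v = 0)"


section \<open>The exterior algebra and its Fermion module structure\<close>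

text \<open>
  The basis vector indexed by \<open>{i\<^sub>1 < \<dots> < i\<^sub>k}\<close> is the monomial \<open>\<xi>\<^bsub>i\<^sub>1\<^esub> \<cdots> \<xi>\<^bsub>i\<^sub>k\<^esub>\<close>.
  The product of two monomials on disjoint index sets is the monomial on the union, up to the sign
  of the permutation that sorts the concatenated indices.
\<close>

type_synonym ext = "nat fset \<Rightarrow>\<^sub>0 complex"

abbreviation ext_one :: ext
  where "ext_one \<equiv> basis {||}"

abbreviation xi :: "nat \<Rightarrow> ext"
  where "xi n \<equiv> basis {|n|}"

definition inversions :: "nat fset \<Rightarrow> nat fset \<Rightarrow> nat"
  where "inversions S T = card {(i, j). i |\<in>| S \<and> j |\<in>| T \<and> j < i}"

definition ext_basis_mult :: "nat fset \<Rightarrow> nat fset \<Rightarrow> ext"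
  where "ext_basis_mult S T =
    (if S |\<inter>| T = {||} then pscale ((-1) ^ inversions S T) (basis (S |\<union>| T)) else 0)"

definition ext_mult :: "ext \<Rightarrow> ext \<Rightarrow> ext"
  where "ext_mult x y = lin_ext (\<lambda>S. lin_ext (ext_basis_mult S) y) x"

definition below :: "nat fset \<Rightarrow> nat \<Rightarrow> nat"
  where "below S n = card {i. i |\<in>| S \<and> i < n}"

text \<open>
  The odd derivation with respect to \<open>\<xi>\<^sub>n\<close>; on a monomial, \<open>\<xi>\<^sub>n\<close> is first moved to the front.
\<close>

definition ext_deriv :: "nat \<Rightarrow> ext \<Rightarrow> ext"
  where "ext_deriv n = lin_ext (\<lambda>S.
    if n |\<in>| S then pscale ((-1) ^ below S n) (basis (S |-| {|n|})) else 0)"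

lemma ext_mult_linear:
  "ext_mult (x + x') y = ext_mult x y + ext_mult x' y"
  "ext_mult x (y + y') = ext_mult x y + ext_mult x y'"
  "ext_mult (pscale c x) y = pscale c (ext_mult x y)"
  "ext_mult x (pscale c y) = pscale c (ext_mult x y)"
  by (simp_all add: ext_mult_def lin_ext_add lin_ext_scale lin_ext_fun_add lin_ext_fun_scale)

lemma ext_mult_minus:
  "ext_mult (- x) y = - ext_mult x y"
  "ext_mult (x - x') y = ext_mult x y - ext_mult x' y"
proof -
  show minus: "ext_mult (- x) y = - ext_mult x y" for x
    using ext_mult_linear(3)[of "-1" x y] by simp
  show "ext_mult (x - x') y = ext_mult x y - ext_mult x' y"
    using ext_mult_linear(1)[of x "- x'" y] by (simp add: minus)
qed

lemma ext_mult_zero [simp]: "ext_mult 0 y = 0" "ext_mult x 0 = 0"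
  by (simp_all add: ext_mult_def)

lemma ext_mult_basis: "ext_mult (basis S) (basis T) = ext_basis_mult S T"
  by (simp add: ext_mult_def)

lemma ext_deriv_linear:
  "ext_deriv n (x + y) = ext_deriv n x + ext_deriv n y"
  "ext_deriv n (pscale c x) = pscale c (ext_deriv n x)"
  by (simp_all add: ext_deriv_def lin_ext_add lin_ext_scale)

lemma ext_deriv_zero [simp]: "ext_deriv n 0 = 0"
  by (simp add: ext_deriv_def)

lemmas ext_linear = ext_mult_linear ext_deriv_linear

lemma inversions_singleton: "inversions {|k|} T = below T k"
proof -
  have "{(i, j). i |\<in>| {|k|} \<and> j |\<in>| T \<and> j < i} = Pair k ` {j. j |\<in>| T \<and> j < k}" by auto
  then show ?thesis by (simp add: inversions_def below_def card_image inj_on_def)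
qed

lemma xi_mult_basis:
  "ext_mult (xi k) (basis S) = (if k |\<in>| S then 0 else pscale ((-1) ^ below S k) (basis (finsert k S)))"
  by (auto simp: ext_mult_basis ext_basis_mult_def inversions_singleton)

lemma ext_deriv_basis:
  "ext_deriv k (basis S) = (if k |\<in>| S then pscale ((-1) ^ below S k) (basis (S |-| {|k|})) else 0)"
  by (simp add: ext_deriv_def)

lemma below_finsert:
  assumes "j |\<notin>| S"
  shows "below (finsert j S) k = (if j < k then Suc (below S k) else below S k)"
proof -
  have "{i. i |\<in>| finsert j S \<and> i < k} =
      (if j < k then insert j {i. i |\<in>| S \<and> i < k} else {i. i |\<in>| S \<and> i < k})"
    by auto
  then show ?thesis using assms by (simp add: below_def)
qed

lemma below_remove:
  assumes "j |\<in>| S"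
  shows "below S k = (if j < k then Suc (below (S |-| {|j|}) k) else below (S |-| {|j|}) k)"
proof -
  have "below (finsert j (S |-| {|j|})) k =
     (if j < k then Suc (below (S |-| {|j|}) k) else below (S |-| {|j|}) k)"
    by (rule below_finsert) simp
  moreover have "finsert j (S |-| {|j|}) = S" using assms by auto
  ultimately show ?thesis by simp
qed

lemma xi_xi: "ext_mult (xi j) (ext_mult (xi k) v) = - ext_mult (xi k) (ext_mult (xi j) v)"
  using basis_span_UNIV[of v]
proof (induction rule: basis_span_induct)
  case (basis S)
  then show ?case
    by (cases j k rule: linorder_cases)
      (auto simp: xi_mult_basis ext_linear below_finsert finsert_commute mult.commute)
qed (simp_all add: ext_linear pm.scale_right_distrib)

lemma deriv_deriv: "ext_deriv j (ext_deriv k v) = - ext_deriv k (ext_deriv j v)"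
  using basis_span_UNIV[of v]
proof (induction rule: basis_span_induct)
  case (basis S)
  show ?case
  proof (cases "j = k")
    case True
    then show ?thesis by (simp add: ext_deriv_basis ext_linear)
  next
    case False
    show ?thesis
    proof (cases "j |\<in>| S \<and> k |\<in>| S")
      case both: True
      define T where "T = S |-| {|j|} |-| {|k|}"
      have T: "S |-| {|k|} |-| {|j|} = T" "S |-| {|j|} |-| {|k|} = T" by (auto simp: T_def)
      have sgn: "(-1 :: complex) ^ below S k * (-1) ^ below (S |-| {|k|}) j
          = - ((-1) ^ below S j * (-1) ^ below (S |-| {|j|}) k)"
        using both False by (simp add: below_remove[of j S k] below_remove[of k S j])
      have "ext_deriv j (ext_deriv k (basis S)) = pscale ((-1) ^ below S k * (-1) ^ below (S |-| {|k|}) j) (basis T)"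
        "ext_deriv k (ext_deriv j (basis S)) = pscale ((-1) ^ below S j * (-1) ^ below (S |-| {|j|}) k) (basis T)"
        using both False by (simp_all add: ext_deriv_basis ext_linear T)
      then show ?thesis by (simp only: sgn pm.scale_minus_left)
    qed (auto simp: ext_deriv_basis ext_linear)
  qed
qed (simp_all add: ext_linear pm.scale_right_distrib)

lemma deriv_xi:
  "ext_deriv j (ext_mult (xi k) v) = (if j = k then v else 0) - ext_mult (xi k) (ext_deriv j v)"
  using basis_span_UNIV[of v]
proof (induction rule: basis_span_induct)
  case (basis S)
  show ?case
  proof (cases "j = k")
    case True
    show ?thesis
    proof (cases "k |\<in>| S")
      case k: True
      then have "finsert k (S |-| {|k|}) = S" by auto
      moreover have "below S k = below (S |-| {|k|}) k" using below_remove[OF k, of k] by simp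
      ultimately show ?thesis using True k
        by (simp add: xi_mult_basis ext_deriv_basis ext_linear flip: power_add)
    next
      case k: False
      then have "finsert k S |-| {|k|} = S" by auto
      moreover have "below (finsert k S) k = below S k" using below_finsert[OF k, of k] by simp
      ultimately show ?thesis using True k
        by (simp add: xi_mult_basis ext_deriv_basis ext_linear flip: power_add)
    qed
  next
    case False
    show ?thesis
    proof (cases "j |\<in>| S \<and> k |\<notin>| S")
      case both: True
      define T where "T = finsert k S |-| {|j|}"
      have T: "finsert k S |-| {|j|} = T" "finsert k (S |-| {|j|}) = T" using False by (auto simp: T_def)
      have sgn: "(-1 :: complex) ^ below S k * (-1) ^ below (finsert k S) j
          = - ((-1) ^ below S j * (-1) ^ below (S |-| {|j|}) k)"
        using both False by (simp add: below_remove[of j S k] below_finsert)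
      have "ext_deriv j (ext_mult (xi k) (basis S)) = pscale ((-1) ^ below S k * (-1) ^ below (finsert k S) j) (basis T)"
        "ext_mult (xi k) (ext_deriv j (basis S)) = pscale ((-1) ^ below S j * (-1) ^ below (S |-| {|j|}) k) (basis T)"
        using both False by (simp_all add: xi_mult_basis ext_deriv_basis ext_linear T)
      then show ?thesis using False by (simp only: sgn pm.scale_minus_left if_False diff_0)
    qed (use False in \<open>auto simp: xi_mult_basis ext_deriv_basis ext_linear\<close>)
  qed
qed (simp_all add: ext_linear pm.scale_right_diff_distrib)

text \<open>
  The product is the exterior algebra product: it is associative and unital, the \<open>\<xi>\<^sub>i\<close>
  anticommute and square to zero, and the basis vectors are the increasing monomials.
\<close>

lemma ext_mult_one [simp]: "ext_mult ext_one x = x" "ext_mult x ext_one = x"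
proof -
  show "ext_mult ext_one x = x" using basis_span_UNIV[of x]
    by (induction rule: basis_span_induct)
      (simp_all add: ext_linear ext_mult_basis ext_basis_mult_def inversions_def)
  show "ext_mult x ext_one = x" using basis_span_UNIV[of x]
    by (induction rule: basis_span_induct)
      (simp_all add: ext_linear ext_mult_basis ext_basis_mult_def inversions_def)
qed

lemma xi_anticommute: "ext_mult (xi j) (xi k) = - ext_mult (xi k) (xi j)"
  using xi_xi[of j k ext_one] by simp

lemma xi_square: "ext_mult (xi k) (xi k) = 0"
  by (simp add: xi_mult_basis)

lemma basis_eq_xi_mult:
  assumes "\<And>i. i |\<in>| S \<Longrightarrow> k < i"
  shows "basis (finsert k S) = ext_mult (xi k) (basis S)"
proof -
  have "{i. i |\<in>| S \<and> i < k} = {}" "k |\<notin>| S" using assms by (auto dest: assms)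
  then have "below S k = 0" by (simp only: below_def card.empty)
  with \<open>k |\<notin>| S\<close> show ?thesis by (simp add: xi_mult_basis)
qed

lemma ext_induct [case_names zero add scale one xi]:
  assumes "P 0" "\<And>x y. P x \<Longrightarrow> P y \<Longrightarrow> P (x + y)" "\<And>c x. P x \<Longrightarrow> P (pscale c x)"
    "P ext_one" "\<And>k x. P x \<Longrightarrow> P (ext_mult (xi k) x)"
  shows "P x"
  using basis_span_UNIV[of x]
proof (induction rule: basis_span_induct)
  case (basis S)
  show ?case
  proof (induction S rule: fset_induct_stronger)
    case empty
    then show ?case using assms(4) by simp
  next
    case (insert k S)
    have "basis (finsert k S) = pscale ((-1) ^ below S k) (ext_mult (xi k) (basis S))"
      using insert.hyps by (simp add: xi_mult_basis flip: power_add)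
    then show ?case using assms(3,5) insert by simp
  qed
qed (use assms in auto)

lemma inversions_Un_left:
  assumes "S |\<inter>| T = {||}"
  shows "inversions (S |\<union>| T) U = inversions S U + inversions T U"
proof -
  have eq: "{(i, j). i |\<in>| S |\<union>| T \<and> j |\<in>| U \<and> j < i} =
      {(i, j). i |\<in>| S \<and> j |\<in>| U \<and> j < i} \<union> {(i, j). i |\<in>| T \<and> j |\<in>| U \<and> j < i}" by auto
  have fin: "finite {(i, j). i |\<in>| A \<and> j |\<in>| U \<and> j < i}" for A
    by (rule finite_subset[of _ "fset A \<times> fset U"]) auto
  show ?thesis unfolding inversions_def eq
    by (rule card_Un_disjoint) (use fin assms in auto)
qed

lemma inversions_Un_right:
  assumes "T |\<inter>| U = {||}"
  shows "inversions S (T |\<union>| U) = inversions S T + inversions S U"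
proof -
  have eq: "{(i, j). i |\<in>| S \<and> j |\<in>| T |\<union>| U \<and> j < i} =
      {(i, j). i |\<in>| S \<and> j |\<in>| T \<and> j < i} \<union> {(i, j). i |\<in>| S \<and> j |\<in>| U \<and> j < i}" by auto
  have fin: "finite {(i, j). i |\<in>| S \<and> j |\<in>| A \<and> j < i}" for A
    by (rule finite_subset[of _ "fset S \<times> fset A"]) auto
  show ?thesis unfolding inversions_def eq
    by (rule card_Un_disjoint) (use fin assms in auto)
qed

lemma ext_mult_assoc: "ext_mult (ext_mult x y) w = ext_mult x (ext_mult y w)"
  using basis_span_UNIV[of x]
proof (induction rule: basis_span_induct)
  case (basis S)
  show ?case using basis_span_UNIV[of y]
  proof (induction rule: basis_span_induct)
    case (basis T)
    show ?case using basis_span_UNIV[of w]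
    proof (induction rule: basis_span_induct)
      case (basis U)
      show ?case
      proof (cases "S |\<inter>| T = {||} \<and> T |\<inter>| U = {||} \<and> S |\<inter>| U = {||}")
        case True
        then show ?thesis
          by (simp add: ext_mult_basis ext_basis_mult_def ext_linear inversions_Un_left
            inversions_Un_right inf_sup_distrib1 inf_sup_distrib2 power_add sup_assoc mult_ac)
      next
        case False
        then show ?thesis
          by (auto simp: ext_mult_basis ext_basis_mult_def ext_linear inf_sup_distrib1 inf_sup_distrib2)
      qed
    qed (simp_all add: ext_linear)
  qed (simp_all add: ext_linear)
qed (simp_all add: ext_linear)

lemma ext_deriv_one: "ext_deriv n ext_one = 0"
  by (simp add: ext_deriv_basis)

lemma ext_deriv_xi: "ext_deriv n (xi k) = (if n = k then ext_one else 0)"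
  using deriv_xi[of n k ext_one] by (simp add: ext_deriv_one)

fun ext_basis_act :: "fermion_index \<Rightarrow> ext \<Rightarrow> ext"
  where
    "ext_basis_act (Psi n) v =
       (if n > 0 then ext_deriv (nat n) v
        else if n < 0 then ext_mult (xi (nat (- n))) v
        else pscale (1 / complex_of_real (sqrt 2)) (ext_mult (xi 0) v + ext_deriv 0 v))"
  | "ext_basis_act Zc v = v"

definition ext_act :: "fermion \<Rightarrow> ext \<Rightarrow> ext"
  where "ext_act x v = lin_ext (\<lambda>b. ext_basis_act b v) x"

definition ext_deg :: "nat fset \<Rightarrow> bit"
  where "ext_deg S = of_nat (fcard S)"

definition ext_part :: "bit \<Rightarrow> ext set"
  where "ext_part i = basis_span {S. ext_deg S = i}"

definition ext_trunc_part :: "nat \<Rightarrow> bit \<Rightarrow> ext set"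
  where "ext_trunc_part m i = basis_span {S \<in> {S. fset S \<subseteq> {..m}}. ext_deg S = i}"


lemma ext_deg_finsert: "k |\<notin>| S \<Longrightarrow> ext_deg (finsert k S) = ext_deg S + 1"
  by (simp add: ext_deg_def fcard_finsert_disjoint add.commute del: bit_not_zero_iff bit_not_one_iff)

lemma ext_deg_remove:
  assumes "k |\<in>| S"
  shows "ext_deg (S |-| {|k|}) = ext_deg S + 1"
proof -
  have "ext_deg (finsert k (S |-| {|k|})) = ext_deg (S |-| {|k|}) + 1"
    by (rule ext_deg_finsert) simp
  moreover have "finsert k (S |-| {|k|}) = S" using assms by auto
  ultimately have "ext_deg S = ext_deg (S |-| {|k|}) + 1" by simp
  then show ?thesis by simp
qed

lemma ext_deriv_mult:
  assumes "a \<in> ext_part i"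
  shows "ext_deriv n (ext_mult a b) =
    ext_mult (ext_deriv n a) b + pscale (if i = 1 then -1 else 1) (ext_mult a (ext_deriv n b))"
  using assms unfolding ext_part_def
proof (induction rule: basis_span_induct)
  case (basis S)
  have "ext_deriv n (ext_mult (basis S) b) =
    ext_mult (ext_deriv n (basis S)) b + pscale ((-1) ^ fcard S) (ext_mult (basis S) (ext_deriv n b))"
  proof (induction S rule: fset_induct_stronger)
    case empty
    then show ?case by (simp add: ext_deriv_one fcard.rep_eq)
  next
    case (insert k S)
    have "basis (finsert k S) = pscale ((-1) ^ below S k) (ext_mult (xi k) (basis S))"
      using insert.hyps by (simp add: xi_mult_basis flip: power_add)
    then show ?case using insert
      by (simp add: ext_linear ext_mult_minus ext_mult_assoc deriv_xi fcard_finsert_disjoint pm.scale_right_distrib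
         pm.scale_right_diff_distrib pm.scale_left_distrib pm.scale_minus_left mult.commute)
  qed
  moreover have "(-1) ^ fcard S = (if i = 1 then -1 else 1 :: complex)"
    using basis by (cases "even (fcard S)") (auto simp: ext_deg_def elim!: oddE)
  ultimately show ?case by simp
qed (simp_all add: ext_linear pm.scale_right_distrib mult.commute)

lemma ext_basis_act_linear:
  "ext_basis_act b (v + w) = ext_basis_act b v + ext_basis_act b w"
  "ext_basis_act b (pscale c v) = pscale c (ext_basis_act b v)"
  by (cases b; simp add: ext_linear pm.scale_right_distrib mult.commute)+

lemma ext_act_linear:
  "ext_act (x + y) v = ext_act x v + ext_act y v"
  "ext_act x (v + w) = ext_act x v + ext_act x w"
  "ext_act (pscale c x) v = pscale c (ext_act x v)"
  "ext_act x (pscale c v) = pscale c (ext_act x v)"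
  by (simp_all add: ext_act_def lin_ext_add lin_ext_scale ext_basis_act_linear lin_ext_fun_add lin_ext_fun_scale)

lemma ext_act_zero [simp]: "ext_act 0 v = 0" "ext_act x 0 = 0"
  using ext_act_linear(3)[of 0 0 v] ext_act_linear(4)[of x 0 0] by simp_all

lemma ext_act_basis: "ext_act (basis b) v = ext_basis_act b v"
  by (simp add: ext_act_def)

lemma sqrt2_factor: "1 / complex_of_real (sqrt 2) * (1 / complex_of_real (sqrt 2)) = 1 / 2"
  by (simp add: divide_simps flip: of_real_mult)

lemma psi_zero_square: "ext_basis_act (Psi 0) (ext_basis_act (Psi 0) v) = pscale (1/2) v"
proof -
  have "ext_mult (xi 0) (ext_mult (xi 0) v) = 0"
    by (simp add: xi_square flip: ext_mult_assoc)
  moreover have "ext_deriv 0 (ext_deriv 0 v) = 0"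
    using basis_span_UNIV[of v]
    by (induction rule: basis_span_induct) (auto simp: ext_linear ext_deriv_basis)
  moreover have "ext_basis_act (Psi 0) (ext_basis_act (Psi 0) v) =
      pscale (1 / complex_of_real (sqrt 2) * (1 / complex_of_real (sqrt 2)))
       (ext_mult (xi 0) (ext_mult (xi 0) v) + ext_mult (xi 0) (ext_deriv 0 v)
        + (ext_deriv 0 (ext_mult (xi 0) v) + ext_deriv 0 (ext_deriv 0 v)))"
    by (simp add: ext_linear pm.scale_right_distrib)
  ultimately show ?thesis by (simp only: sqrt2_factor deriv_xi) simp
qed

lemma psi_anticommute:
  "ext_basis_act (Psi m) (ext_basis_act (Psi n) v) =
     (if m = - n then v else 0) - ext_basis_act (Psi n) (ext_basis_act (Psi m) v)"
proof (cases "m = 0 \<and> n = 0")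
  case True
  have "v - pscale (1/2) v = pscale (1/2) v"
    by (rule poly_mapping_eqI) (simp add: lookup_minus)
  then show ?thesis using True by (simp add: psi_zero_square del: ext_basis_act.simps)
next
  case False
  have nat_eq: "nat m = nat (- n) \<longleftrightarrow> m = - n" if "m > 0" "n < 0"
    using that by auto
  have nat_eq': "nat n = nat (- m) \<longleftrightarrow> m = - n" if "n > 0" "m < 0"
    using that by auto
  consider "m > 0" "n > 0" | "m > 0" "n = 0" | "m > 0" "n < 0" | "m = 0" "n > 0" | "m = 0" "n < 0"
    | "m < 0" "n > 0" | "m < 0" "n = 0" | "m < 0" "n < 0"
    using False by linarith
  then show ?thesis
  proof cases
    case 1 then show ?thesis using deriv_deriv[of "nat m" "nat n" v] by simp
  next
    case 2 then show ?thesis using deriv_deriv[of "nat m" 0 v]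
      by (simp add: deriv_xi ext_linear pm.scale_right_distrib pm.scale_right_diff_distrib)
  next
    case 3 then show ?thesis using deriv_xi[of "nat m" "nat (- n)" v] nat_eq by simp
  next
    case 4 then show ?thesis using deriv_deriv[of 0 "nat n" v]
      by (simp add: deriv_xi ext_linear pm.scale_right_distrib pm.scale_right_diff_distrib)
  next
    case 5 then show ?thesis using xi_xi[of 0 "nat (- n)" v]
      by (simp add: deriv_xi ext_linear pm.scale_right_distrib pm.scale_right_diff_distrib)
  next
    case 6 then show ?thesis using deriv_xi[of "nat n" "nat (- m)" v] nat_eq' by simp
  next
    case 7 then show ?thesis using xi_xi[of "nat (- m)" 0 v]
      by (simp add: deriv_xi ext_linear pm.scale_right_distrib pm.scale_right_diff_distrib)
  next
    case 8 then show ?thesis using xi_xi[of "nat (- m)" "nat (- n)" v] by simp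
  qed
qed

lemma ext_act_br:
  assumes "x \<in> basis_span {b \<in> A. fermion_deg b = i}" "y \<in> basis_span {b \<in> A. fermion_deg b = j}"
  shows "ext_act (fermion_br x y) v = ext_act x (ext_act y v) - pscale (koszul i j) (ext_act y (ext_act x v))"
  using assms(1)
proof (induction rule: basis_span_induct)
  case (basis a)
  show ?case using assms(2)
  proof (induction rule: basis_span_induct)
    case b: (basis b)
    show ?case
    proof (cases a; cases b)
      fix m n assume ab: "a = Psi m" "b = Psi n"
      have "koszul i j = -1" using basis b ab by (auto simp: koszul_def)
      then show ?case
        unfolding ab ext_act_basis fermion_br_basis fermion_basis_br.simps psi_anticommute[of m n]
        by (simp add: ext_act_basis del: ext_basis_act.simps(1))
    qed (use basis b in \<open>auto simp: koszul_def ext_act_basis simp del: ext_basis_act.simps(1)\<close>)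
  qed (simp_all only: fermion_br_linear fermion_br_zero ext_act_linear ext_act_zero pm.scale_right_distrib
      pm.scale_zero_right diff_zero pm.scale_left_commute[of "koszul i j"] pm.scale_right_diff_distrib add_diff_add)
qed (simp_all only: fermion_br_linear fermion_br_zero ext_act_linear ext_act_zero pm.scale_right_distrib
      pm.scale_zero_right diff_zero pm.scale_left_commute[of "koszul i j"] pm.scale_right_diff_distrib add_diff_add)

lemma ext_act_mem:
  assumes "x \<in> basis_span A" "v \<in> basis_span B" "pm.subspace W"
    "\<And>a S. a \<in> A \<Longrightarrow> S \<in> B \<Longrightarrow> ext_basis_act a (basis S) \<in> W"
  shows "ext_act x v \<in> W"
  unfolding ext_act_def
proof (rule lin_ext_mem[OF assms(3,1)])
  fix a assume "a \<in> A"
  from assms(2) show "ext_basis_act a v \<in> W"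
  proof (induction rule: basis_span_induct)
    case zero
    show ?case using pm.subspace_0[OF assms(3)] by (cases a) auto
  qed (use assms(3,4) \<open>a \<in> A\<close> in \<open>auto simp: ext_basis_act_linear pm.subspace_add pm.subspace_scale\<close>)
qed

lemma lie_supermodule_ext_on:
  assumes "Zc \<in> A" and closed: "\<And>n S. Psi n \<in> A \<Longrightarrow> S \<in> B \<Longrightarrow>
    finsert (nat \<bar>n\<bar>) S \<in> B \<and> S |-| {|nat \<bar>n\<bar>|} \<in> B"
  shows "lie_supermodule pscale (\<lambda>i. basis_span {b \<in> A. fermion_deg b = i}) fermion_br
    pscale (\<lambda>i. basis_span {S \<in> B. ext_deg S = i}) ext_act"
proof (intro lie_supermodule.intro lie_superalgebra_fermion_on assms super_space_basis_span lie_supermodule_axioms.intro)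
  fix x v i j assume "x \<in> basis_span {b \<in> A. fermion_deg b = i}" "v \<in> basis_span {S \<in> B. ext_deg S = j}"
  then show "ext_act x v \<in> basis_span {S \<in> B. ext_deg S = i + j}"
  proof (rule ext_act_mem[OF _ _ subspace_basis_span])
    fix a S assume a: "a \<in> {b \<in> A. fermion_deg b = i}" and S: "S \<in> {S \<in> B. ext_deg S = j}"
    show "ext_basis_act a (basis S) \<in> basis_span {S \<in> B. ext_deg S = i + j}"
    proof (cases a)
      case Zc
      then show ?thesis using a S by (simp add: basis_span_def)
    next
      case (Psi n)
      define N where "N = nat \<bar>n\<bar>"
      have N: "finsert N S \<in> B" "S |-| {|N|} \<in> B"
        using closed a S Psi by (auto simp: N_def)
      have i: "i = 1" using a Psi by auto
      let ?W = "basis_span {S \<in> B. ext_deg S = i + j}"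
      have "basis (finsert N S) \<in> ?W" if "N |\<notin>| S"
        using N that S i by (simp add: basis_span_def ext_deg_finsert add.commute)
      then have m: "ext_mult (xi N) (basis S) \<in> ?W"
        by (auto simp: xi_mult_basis pm.subspace_0[OF subspace_basis_span]
          intro!: pm.subspace_scale[OF subspace_basis_span])
      have "basis (S |-| {|N|}) \<in> ?W" if "N |\<in>| S"
        using N that S i by (simp add: basis_span_def ext_deg_remove add.commute)
      then have d: "ext_deriv N (basis S) \<in> ?W"
        by (auto simp: ext_deriv_basis pm.subspace_0[OF subspace_basis_span]
          intro!: pm.subspace_scale[OF subspace_basis_span])
      show ?thesis using m d Psi
        by (auto simp: N_def intro!: pm.subspace_scale[OF subspace_basis_span] pm.subspace_add[OF subspace_basis_span])
    qed
  qed
qed (rule ext_act_linear | erule (1) ext_act_br)+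

theorem lie_supermodule_ext: "lie_supermodule pscale fermion_part fermion_br pscale ext_part ext_act"
  using lie_supermodule_ext_on[of UNIV UNIV]
  by (simp only: fermion_part_def[abs_def] ext_part_def[abs_def] UNIV_I simp_thms True_implies_equals)

theorem lie_supermodule_ext_trunc:
  "lie_supermodule pscale (fermion_trunc_part m) fermion_br pscale (ext_trunc_part m) ext_act"
  unfolding fermion_trunc_part_def[abs_def] ext_trunc_part_def[abs_def]
  by (rule lie_supermodule_ext_on) auto

end

(* On a simple module with z acting as lam = mu^2, applying the finitely many psi_n (n > 0) that do not
   kill a homogeneous vector produces a vacuum w, killed by every psi_n with n > 0; since
   psi_0 psi_0 = lam/2 is invertible, psi_0 w is a vacuum of the other parity, so w may be taken even.
   Then xi_{i_1} ... xi_{i_k} |-> (creation operators applied to w) intertwines the twisted exterior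
   module with V.  It is onto by simplicity.  It is injective because the number operators
   psi_{-n} psi_n and the parity separate the monomials, none of which is sent to 0. *)

theory Submission
  imports Defs
begin

section \<open>Windows of modes and coordinate projections in the exterior algebra\<close>

definition fermion_window :: "nat set \<Rightarrow> fermion_index set"
  where "fermion_window J = insert Zc (Psi ` {n. nat \<bar>n\<bar> \<in> J})"

definition ext_window :: "nat set \<Rightarrow> nat fset set"
  where "ext_window J = {S. fset S \<subseteq> J}"

lemma fermion_window_iff [simp]:
  "Psi n \<in> fermion_window J \<longleftrightarrow> nat \<bar>n\<bar> \<in> J" "Zc \<in> fermion_window J"
  by (auto simp: fermion_window_def)

text \<open>Peels off the least index because it is the leftmost factor of an increasing monomial:
  then \<open>basis (finsert k S)\<close> is \<open>xi k\<close> times \<open>basis S\<close>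
  without a sign.\<close>

lemma fset_linorder_min_induct [case_names empty insert]:
  fixes S :: "'a::linorder fset"
  assumes "P {||}" "\<And>k S. (\<And>i. i |\<in>| S \<Longrightarrow> k < i) \<Longrightarrow> P S \<Longrightarrow> P (finsert k S)"
  shows "P S"
proof (induction "fcard S" arbitrary: S)
  case 0
  then show ?case using assms(1) by simp
next
  case (Suc n)
  define k where "k = Min (fset S)"
  have ne: "fset S \<noteq> {}" using Suc.hyps(2) by (auto simp: fcard.rep_eq)
  then have k: "k |\<in>| S" by (simp add: k_def)
  let ?S = "S |-| {|k|}"
  have "k < i" if "i |\<in>| ?S" for i
    using that by (auto simp: k_def order_less_le)
  moreover have "P ?S" using Suc k by (intro Suc.hyps) (simp add: fcard_fminus_fsingleton)
  moreover have "finsert k ?S = S" using k by auto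
  ultimately show ?case using assms(2)[of ?S k] by metis
qed

lemma basis_span_basis [simp]: "basis b \<in> basis_span A \<longleftrightarrow> b \<in> A"
  by (simp add: basis_span_def)

lemma basis_span_mono: "A \<subseteq> B \<Longrightarrow> basis_span A \<subseteq> basis_span B"
  by (auto simp: basis_span_def)

lemma basis_span_zero [simp]: "0 \<in> basis_span A"
  by (simp add: basis_span_def)

lemma basis_span_scale: "x \<in> basis_span A \<Longrightarrow> pscale c x \<in> basis_span A"
  by (rule pm.subspace_scale[OF subspace_basis_span])

lemma basis_span_add: "x \<in> basis_span A \<Longrightarrow> y \<in> basis_span A \<Longrightarrow> x + y \<in> basis_span A"
  by (rule pm.subspace_add[OF subspace_basis_span])

text \<open>Up to scalars, \<open>Psi n\<close> inserts or deletes the single index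
  \<open>nat \<bar>n\<bar>\<close> (for \<open>n = 0\<close> it combines both), and deletion never
  leaves the window.\<close>

lemma ext_basis_act_window:
  assumes "nat \<bar>n\<bar> \<in> J" "x \<in> basis_span (ext_window J)"
  shows "ext_basis_act (Psi n) x \<in> basis_span (ext_window J)"
  using assms(2)
proof (induction rule: basis_span_induct)
  case (basis S)
  have "ext_mult (xi (nat \<bar>n\<bar>)) (basis S) \<in> basis_span (ext_window J)"
    using basis assms(1) by (auto simp: xi_mult_basis ext_window_def intro!: basis_span_scale)
  moreover have "ext_deriv (nat \<bar>n\<bar>) (basis S) \<in> basis_span (ext_window J)"
    using basis by (auto simp: ext_deriv_basis ext_window_def intro!: basis_span_scale)
  ultimately show ?case
    by (auto intro!: basis_span_scale basis_span_add)
qed (simp_all only: ext_basis_act_linear basis_span_add basis_span_scale,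
     simp add: pm.subspace_0[OF subspace_basis_span])

lemma ext_act_window:
  assumes "y \<in> basis_span (fermion_window J)" "x \<in> basis_span (ext_window J)"
  shows "ext_act y x \<in> basis_span (ext_window J)"
proof (rule ext_act_mem[OF assms subspace_basis_span])
  fix a S assume "a \<in> fermion_window J" "S \<in> ext_window J"
  then show "ext_basis_act a (basis S) \<in> basis_span (ext_window J)"
    by (cases a) (auto simp: fermion_window_def simp del: ext_basis_act.simps(1) intro!: ext_basis_act_window)
qed

text \<open>The coordinate projection onto the basis vectors satisfying \<open>Q\<close>; number
  operators and parity act through such projections.\<close>

definition restrict_keys :: "('b \<Rightarrow> bool) \<Rightarrow> ('b \<Rightarrow>\<^sub>0 complex) \<Rightarrow> ('b \<Rightarrow>\<^sub>0 complex)"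
  where "restrict_keys Q = lin_ext (\<lambda>b. if Q b then basis b else 0)"

lemma lookup_restrict_keys:
  "Poly_Mapping.lookup (restrict_keys Q x) b = (if Q b then Poly_Mapping.lookup x b else 0)"
  using basis_span_UNIV[of x] unfolding restrict_keys_def
  by (induction rule: basis_span_induct)
    (auto simp: lin_ext_add lin_ext_scale lookup_add lookup_single when_def)

lemma keys_restrict_keys: "Poly_Mapping.keys (restrict_keys Q x) = {b \<in> Poly_Mapping.keys x. Q b}"
  by (auto simp: in_keys_iff lookup_restrict_keys split: if_splits)

lemma restrict_keys_linear:
  "restrict_keys Q (x + y) = restrict_keys Q x + restrict_keys Q y"
  "restrict_keys Q (pscale c x) = pscale c (restrict_keys Q x)"
  by (simp_all add: restrict_keys_def lin_ext_add lin_ext_scale)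

lemma restrict_keys_basis: "restrict_keys Q (basis b) = (if Q b then basis b else 0)"
  by (simp add: restrict_keys_def)

text \<open>This is the number operator of mode \<open>n\<close>. It is diagonal on monomials with
  eigenvalues 0 and 1, since moving the generator out and back in costs the same sign twice.\<close>

lemma xi_mult_deriv: "ext_mult (xi n) (ext_deriv n x) = restrict_keys (\<lambda>S. n |\<in>| S) x"
  using basis_span_UNIV[of x]
proof (induction rule: basis_span_induct)
  case (basis S)
  show ?case
  proof (cases "n |\<in>| S")
    case True
    then have "finsert n (S |-| {|n|}) = S" by auto
    then show ?thesis using True below_remove[of n S n]
      by (simp add: ext_deriv_basis xi_mult_basis ext_linear restrict_keys_basis flip: power_add)
  qed (simp add: ext_deriv_basis restrict_keys_basis)
qed (simp_all add: ext_linear restrict_keys_linear, simp add: restrict_keys_def)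

section \<open>Fermion relations on a simple module with nonzero central scalar\<close>

text \<open>The index set \<open>J\<close> is \<^term>\<open>{..m}\<close> for the truncated algebra and \<^term>\<open>UNIV\<close> for the full one.\<close>

locale simple_fermion_module =
  simple_lie_supermodule pscale "\<lambda>i. basis_span {b \<in> fermion_window J. fermion_deg b = i}"
    fermion_br scale V act
  for J :: "nat set" and scale :: "complex \<Rightarrow> 'v::ab_group_add \<Rightarrow> 'v"
    and V :: "bit \<Rightarrow> 'v set" and act :: "fermion \<Rightarrow> 'v \<Rightarrow> 'v" +
  fixes lam :: complex
  assumes lam_nonzero: "lam \<noteq> 0"
    and act_z: "v \<in> total_space V \<Longrightarrow> act fermion_z v = scale lam v"
    and zero_window: "0 \<in> J"
    and locally_annihilated:
      "v \<in> total_space V \<Longrightarrow> \<exists>N::nat. \<forall>n>N. n \<in> J \<longrightarrow> act (psi (int n)) v = 0"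
begin

lemma total_window:
  "total_space (\<lambda>i. basis_span {b \<in> fermion_window J. fermion_deg b = i}) = basis_span (fermion_window J)"
  by (rule total_space_basis_span)

lemma total_subspace: "M.subspace (total_space V)"
  unfolding total_space_def by (rule M.subspace_sums[OF M.subspace_part M.subspace_part])

lemma part_total: "v \<in> V i \<Longrightarrow> v \<in> total_space V"
proof -
  assume v: "v \<in> V i"
  have "v = v + 0" "v = 0 + v" "0 \<in> V j" for j
    using M.subspace_part by (auto simp: M.subspace_def)
  then show ?thesis
    using v unfolding total_space_def by (cases i) (fastforce simp del: add_0_right add_0_left)+
qed

lemma psi_part: "nat \<bar>n\<bar> \<in> J \<Longrightarrow> psi n \<in> basis_span {b \<in> fermion_window J. fermion_deg b = 1}"
  by simp

lemma psi_graded: "nat \<bar>n\<bar> \<in> J \<Longrightarrow> v \<in> V i \<Longrightarrow> act (psi n) v \<in> V (i + 1)"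
  using act_graded[OF psi_part] by (simp add: add.commute)

lemma psi_add:
  "nat \<bar>n\<bar> \<in> J \<Longrightarrow> v \<in> total_space V \<Longrightarrow> w \<in> total_space V \<Longrightarrow>
    act (psi n) (v + w) = act (psi n) v + act (psi n) w"
  using act_add_right by (simp add: total_window)

lemma psi_scale:
  "nat \<bar>n\<bar> \<in> J \<Longrightarrow> v \<in> total_space V \<Longrightarrow> act (psi n) (scale c v) = scale c (act (psi n) v)"
  using act_scale_right by (simp add: total_window)

lemma psi_total:
  assumes "nat \<bar>n\<bar> \<in> J" "v \<in> total_space V"
  shows "act (psi n) v \<in> total_space V"
proof -
  obtain a b where "a \<in> V 0" "b \<in> V 1" "v = a + b" using assms(2) by (auto simp: total_space_def)
  then show ?thesis
    using assms(1) psi_graded part_total psi_add M.subspace_add[OF total_subspace] by metis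
qed

lemma psi_zero_right: "nat \<bar>n\<bar> \<in> J \<Longrightarrow> act (psi n) 0 = 0"
  using psi_scale[of n 0 0] M.subspace_0[OF total_subspace] by simp

lemma psi_anticomm:
  assumes "nat \<bar>m\<bar> \<in> J" "nat \<bar>n\<bar> \<in> J" "v \<in> total_space V"
  shows "act (psi m) (act (psi n) v) = (if m = - n then scale lam v else 0) - act (psi n) (act (psi m) v)"
proof -
  \<comment> \<open>For \<open>m \<noteq> - n\<close> the bracket is the zero vector; that it acts
    as zero follows from scaling \<open>fermion_z\<close> by 0.\<close>
  have zero: "act 0 v = 0"
    using act_scale_left[of fermion_z v 0] assms(3)
    by (simp add: total_window)
  have "act (fermion_br (psi m) (psi n)) v
      = act (psi m) (act (psi n) v) - scale (koszul 1 1) (act (psi n) (act (psi m) v))"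
    by (rule act_br) (use assms psi_part in auto)
  then show ?thesis using act_z[OF assms(3)] zero
    by (auto simp: koszul_def algebra_simps split: if_splits)
qed

lemma scale_self_add: "v + v = scale 2 v"
  using M.scale_left_distrib[of 1 1 v] by simp

text \<open>The index 0 is its own negative, so twice the square of \<open>psi 0\<close> is
  \<open>lam\<close>. As \<open>lam\<close> is nonzero, \<open>psi 0\<close> acts
  invertibly.\<close>

lemma psi_zero_sq:
  assumes "v \<in> total_space V"
  shows "act (psi 0) (act (psi 0) v) = scale (lam / 2) v"
proof -
  let ?y = "act (psi 0) (act (psi 0) v)"
  have "?y = scale lam v - ?y"
    using psi_anticomm[of 0 0 v] zero_window assms by simp
  then have "scale 2 ?y = scale lam v" by (simp add: eq_diff_eq flip: scale_self_add)
  then have "scale (1/2) (scale 2 ?y) = scale (1/2) (scale lam v)" by simp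
  then show ?thesis by simp
qed

lemma psi_sq:
  assumes "n \<noteq> 0" "nat \<bar>n\<bar> \<in> J" "v \<in> total_space V"
  shows "act (psi n) (act (psi n) v) = 0"
proof -
  have "act (psi n) (act (psi n) v) = - act (psi n) (act (psi n) v)"
    using psi_anticomm[of n n v] assms by simp
  then have "scale 2 (act (psi n) (act (psi n) v)) = 0"
    by (simp add: eq_neg_iff_add_eq_0 flip: scale_self_add)
  then show ?thesis by simp
qed

section \<open>Existence of an even vacuum\<close>

text \<open>Induction on the bound \<open>N\<close>. If mode \<open>Suc N\<close> does not already
  kill \<open>v\<close>, then \<open>v\<close> is replaced by its image under that mode: the mode
  kills the image because its square is zero, and the higher modes kill it because positive modes
  anticommute.\<close>

lemma homogeneous_vacuum:
  assumes "v \<in> V i" "v \<noteq> 0" "\<forall>n>N. n \<in> J \<longrightarrow> act (psi (int n)) v = 0"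
  shows "\<exists>w j. w \<in> V j \<and> w \<noteq> 0 \<and> (\<forall>n>0. n \<in> J \<longrightarrow> act (psi (int n)) w = 0)"
  using assms
proof (induction N arbitrary: v i)
  case 0
  then show ?case by blast
next
  case (Suc N)
  show ?case
  proof (cases "Suc N \<in> J \<and> act (psi (int (Suc N))) v \<noteq> 0")
    case False
    then have "\<forall>n>N. n \<in> J \<longrightarrow> act (psi (int n)) v = 0"
      using Suc.prems(3) by (metis Suc_lessI)
    then show ?thesis using Suc by blast
  next
    case True
    let ?w = "act (psi (int (Suc N))) v"
    have v: "v \<in> total_space V" using Suc.prems(1) part_total by blast
    have "act (psi (int n)) ?w = 0" if n: "n > N" "n \<in> J" for n
    proof (cases "n = Suc N")
      case True
      then show ?thesis using psi_sq[of "int n" v] n v True by (simp del: of_nat_Suc)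
    next
      case False
      then show ?thesis
        using psi_anticomm[of "int n" "int (Suc N)" v] n v True Suc.prems(3) psi_zero_right[of "int (Suc N)"]
        by (simp del: of_nat_Suc)
    qed
    moreover have "?w \<in> V (i + 1)"
      using Suc.prems(1) True by (intro psi_graded) (simp_all del: of_nat_Suc)
    ultimately show ?thesis using Suc.IH[of ?w "i + 1"] True by blast
  qed
qed

text \<open>The parity matters because isomorphisms preserve degrees and the vacuum has to
  correspond to the even vector \<open>ext_one\<close>.\<close>

lemma even_vacuum:
  obtains w where "w \<in> V 0" "w \<noteq> 0" "\<And>n. n > 0 \<Longrightarrow> n \<in> J \<Longrightarrow> act (psi (int n)) w = 0"
proof -
  obtain i v where v: "v \<in> V i" "v \<noteq> 0"
  proof -
    obtain v where "v \<in> total_space V" "v \<noteq> 0"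
      using nonzero M.subspace_0[OF total_subspace] by blast
    then obtain a b where "a \<in> V 0" "b \<in> V 1" "a + b \<noteq> 0"
      by (auto simp: total_space_def)
    then show thesis using that by (cases "a = 0") auto
  qed
  obtain N where "\<forall>n>N. n \<in> J \<longrightarrow> act (psi (int n)) v = 0"
    using locally_annihilated part_total v(1) by blast
  from homogeneous_vacuum[OF v this] obtain w j where
    w: "w \<in> V j" "w \<noteq> 0" "\<And>n. n > 0 \<Longrightarrow> n \<in> J \<Longrightarrow> act (psi (int n)) w = 0"
    by blast
  show thesis
  proof (cases "j = 0")
    case True
    then show ?thesis using that w by blast
  next
    case False
    then have j: "j + 1 = 0" by simp
    have wT: "w \<in> total_space V" using w part_total by blast
    let ?w = "act (psi 0) w"
    have "?w \<in> V 0" using psi_graded[of 0 w j] zero_window w(1) j by simp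
    \<comment> \<open>Injectivity of \<open>psi 0\<close>: its square is the nonzero scalar
      \<open>lam / 2\<close>.\<close>
    moreover have "?w \<noteq> 0"
    proof
      assume "?w = 0"
      then have "scale (lam / 2) w = 0"
        using psi_zero_sq[OF wT] psi_zero_right[of 0] zero_window by simp
      then show False using w(2) lam_nonzero by simp
    qed
    moreover have "act (psi (int n)) ?w = 0" if "n > 0" "n \<in> J" for n
      using psi_anticomm[of "int n" 0 w] that zero_window wT w(3)[OF that] psi_zero_right[of 0] by simp
    ultimately show ?thesis using that by blast
  qed
qed

end


section \<open>The Fock map attached to a vacuum and a square root of the scalar\<close>

locale fermion_vacuum = simple_fermion_module J scale V act lam
  for J :: "nat set" and scale :: "complex \<Rightarrow> 'v::ab_group_add \<Rightarrow> 'v"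
    and V :: "bit \<Rightarrow> 'v set" and act :: "fermion \<Rightarrow> 'v \<Rightarrow> 'v" and lam :: complex +
  fixes w :: 'v and \<mu> :: complex
  assumes vacuum_even: "w \<in> V 0" and vacuum_nonzero: "w \<noteq> 0"
    and vacuum_annihilated: "\<And>n. n > 0 \<Longrightarrow> n \<in> J \<Longrightarrow> act (psi (int n)) w = 0"
    and mu_sq: "\<mu>\<^sup>2 = lam"
begin

text \<open>
  \<open>cre k\<close> plays the role of multiplication by \<open>\<xi>\<^sub>k\<close>; for \<open>k = 0\<close> it does so only on monomials
  without \<open>\<xi>\<^sub>0\<close>, which is enough because \<open>\<xi>\<^sub>0\<close> is the first factor of an increasing monomial.
\<close>

definition cre :: "nat \<Rightarrow> 'v \<Rightarrow> 'v"
  where "cre k v = scale ((if k = 0 then complex_of_real (sqrt 2) else 1) / \<mu>) (act (psi (- int k)) v)"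

text \<open>The smallest index is applied last, as the outermost operator, in agreement with its
  place as leftmost factor of the increasing product.\<close>

definition monomial :: "nat fset \<Rightarrow> 'v"
  where "monomial S = foldr cre (sorted_list_of_fset S) w"

text \<open>The linear extension of \<open>monomial\<close>, written as a sum because
  \<open>lin_ext\<close> takes values in finitely supported functions whereas the module lies in an
  arbitrary vector space.\<close>

definition fock :: "ext \<Rightarrow> 'v"
  where "fock x = (\<Sum>S\<in>Poly_Mapping.keys x. scale (Poly_Mapping.lookup x S) (monomial S))"

lemma mu_nonzero: "\<mu> \<noteq> 0"
  using mu_sq lam_nonzero by auto

lemma fock_superset:
  assumes "finite A" "Poly_Mapping.keys x \<subseteq> A"
  shows "fock x = (\<Sum>S\<in>A. scale (Poly_Mapping.lookup x S) (monomial S))"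
  unfolding fock_def
  by (rule sum.mono_neutral_left) (use assms in \<open>auto simp: in_keys_iff\<close>)

lemma fock_add: "fock (x + y) = fock x + fock y"
proof -
  let ?A = "Poly_Mapping.keys x \<union> Poly_Mapping.keys y"
  have "fock (x + y) = (\<Sum>S\<in>?A. scale (Poly_Mapping.lookup (x + y) S) (monomial S))"
    by (rule fock_superset) (auto simp: Poly_Mapping.keys_add)
  also have "\<dots> = fock x + fock y"
    by (simp add: lookup_add M.scale_left_distrib sum.distrib fock_superset[of ?A])
  finally show ?thesis .
qed

lemma fock_scale: "fock (pscale c x) = scale c (fock x)"
proof -
  have "fock (pscale c x) =
      (\<Sum>S\<in>Poly_Mapping.keys x. scale (Poly_Mapping.lookup (pscale c x) S) (monomial S))"
    by (rule fock_superset) (auto simp: in_keys_iff)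
  then show ?thesis
    unfolding fock_def by (simp add: M.scale_sum_right)
qed

lemma fock_basis [simp]: "fock (basis S) = monomial S"
  by (simp add: fock_def)

lemma fock_zero [simp]: "fock 0 = 0"
  by (simp add: fock_def)

lemma fock_minus: "fock (- x) = - fock x" "fock (x - y) = fock x - fock y"
proof -
  show "fock (- x) = - fock x" for x using fock_scale[of "-1" x] by simp
  then show "fock (x - y) = fock x - fock y" using fock_add[of x "- y"] by simp
qed

lemma fock_subspace:
  assumes "x \<in> basis_span A" "M.subspace W" "\<And>S. S \<in> A \<Longrightarrow> monomial S \<in> W"
  shows "fock x \<in> W"
  unfolding fock_def
  by (rule M.subspace_sum) (use assms in \<open>auto simp: basis_span_def intro!: M.subspace_scale\<close>)

lemma cre_graded: "k \<in> J \<Longrightarrow> v \<in> V i \<Longrightarrow> cre k v \<in> V (i + 1)"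
  unfolding cre_def by (intro M.subspace_scale M.subspace_part psi_graded) simp_all

lemma cre_linear:
  assumes "k \<in> J" "v \<in> total_space V"
  shows "v' \<in> total_space V \<Longrightarrow> cre k (v + v') = cre k v + cre k v'"
    and "cre k (scale c v) = scale c (cre k v)"
  using assms by (simp_all add: cre_def psi_add psi_scale M.scale_right_distrib mult.commute)

lemma monomial_empty [simp]: "monomial {||} = w"
  by (simp add: monomial_def sorted_list_of_fset.rep_eq)

lemma monomial_finsert:
  assumes "\<And>i. i |\<in>| S \<Longrightarrow> k < i"
  shows "monomial (finsert k S) = cre k (monomial S)"
proof -
  have "k |\<notin>| S" using assms by auto
  then have "sorted_list_of_fset (finsert k S) = insort k (sorted_list_of_fset S)"
    by (simp add: sorted_list_of_fset.rep_eq)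
  also have "\<dots> = k # sorted_list_of_fset S"
    using assms by (intro insort_is_Cons) (auto simp: sorted_list_of_fset.rep_eq less_imp_le)
  finally show ?thesis by (simp add: monomial_def)
qed

text \<open>The vacuum is even and every creation operator flips the parity.\<close>

lemma monomial_part: "S \<in> ext_window J \<Longrightarrow> monomial S \<in> V (ext_deg S)"
proof (induction S rule: fset_linorder_min_induct)
  case empty
  then show ?case using vacuum_even by (simp add: ext_deg_def fcard.rep_eq)
next
  case (insert k S)
  then have "k |\<notin>| S" by auto
  with insert show ?case
    by (simp add: monomial_finsert ext_window_def ext_deg_finsert cre_graded del: add_bit_eq_xor)
qed

lemma monomial_total: "S \<in> ext_window J \<Longrightarrow> monomial S \<in> total_space V"
  using monomial_part part_total by blast

lemma fock_total: "x \<in> basis_span (ext_window J) \<Longrightarrow> fock x \<in> total_space V"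
  using fock_subspace total_subspace monomial_total by blast

lemma fock_part: "x \<in> basis_span {S \<in> ext_window J. ext_deg S = i} \<Longrightarrow> fock x \<in> V i"
  by (rule fock_subspace[OF _ M.subspace_part]) (use monomial_part in auto)

text \<open>No sign arises while \<open>k\<close> stays below all other indices, and this includes
  \<open>k = 0\<close>. It lets later inductions pull out the least factor after the remaining ones
  have been changed.\<close>

lemma fock_xi_min:
  assumes "x \<in> basis_span {S \<in> ext_window J. \<forall>i. i |\<in>| S \<longrightarrow> k < i}" "k \<in> J"
  shows "fock (ext_mult (xi k) x) = cre k (fock x)"
proof -
  \<comment> \<open>Membership is carried through the induction because \<open>cre k\<close> is
    known to be linear only on the module.\<close>
  have "fock x \<in> total_space V \<and> fock (ext_mult (xi k) x) = cre k (fock x)"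
    using assms(1)
  proof (induction rule: basis_span_induct)
    case zero
    have "cre k 0 = 0" using cre_linear(2)[of k 0 0] assms(2) M.subspace_0[OF total_subspace] by simp
    then show ?case using M.subspace_0[OF total_subspace] by simp
  next
    case (add x y)
    then show ?case
      using assms(2) by (simp add: ext_linear fock_add cre_linear M.subspace_add[OF total_subspace])
  next
    case (scale c x)
    then show ?case
      using assms(2) by (simp add: ext_linear fock_scale cre_linear M.subspace_scale[OF total_subspace])
  next
    case (basis S)
    then show ?case
      using monomial_total by (simp add: monomial_finsert flip: basis_eq_xi_mult)
  qed
  then show ?thesis ..
qed

text \<open>Two non-negative modes can sum to zero only if both are 0, so no central term
  appears.\<close>

lemma cre_anticomm:
  assumes "m \<in> J" "n \<in> J" "m \<noteq> n" "v \<in> total_space V"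
  shows "cre m (cre n v) = - cre n (cre m v)"
proof -
  have "\<not> (m = 0 \<and> n = 0)" using assms(3) by auto
  then show ?thesis
    using assms psi_anticomm[of "- int m" "- int n" v]
    by (auto simp: cre_def psi_scale psi_total mult.commute)
qed

section \<open>The Fock map intertwines the actions\<close>

text \<open>Sorts the new factor into place by comparing \<open>n\<close> with the least index
  \<open>k\<close>: if smaller it is in place, if equal both sides vanish, if larger it is swapped
  past \<open>k\<close> on both sides. Mode 0 is excluded because \<open>cre 0\<close> squares to
  the identity while \<open>xi 0\<close> squares to zero.\<close>

lemma fock_xi_basis:
  assumes "n > 0" "n \<in> J" "S \<in> ext_window J"
  shows "fock (ext_mult (xi n) (basis S)) = cre n (monomial S)"
  using assms(3)
proof (induction S rule: fset_linorder_min_induct)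
  case empty
  have "monomial {|n|} = cre n (monomial {||})" by (rule monomial_finsert) auto
  then show ?case by simp
next
  case (insert k S)
  then have kS: "k \<in> J" "S \<in> ext_window J" "k |\<notin>| S" by (auto simp: ext_window_def)
  have S: "basis (finsert k S) = ext_mult (xi k) (basis S)" "monomial (finsert k S) = cre k (monomial S)"
    using insert.hyps by (auto intro: basis_eq_xi_mult monomial_finsert)
  have T: "monomial S \<in> total_space V" using kS monomial_total by blast
  consider "n < k" | "n = k" | "n > k" by linarith
  then show ?case
  proof cases
    case 1
    then have lt: "n < i" if "i |\<in>| finsert k S" for i
      using insert.hyps that by (auto intro: less_trans)
    then show ?thesis
      using monomial_finsert[OF lt] basis_eq_xi_mult[OF lt] by (metis fock_basis)
  next
    case 2
    have "cre n (cre n (monomial S)) = 0"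
      using assms(1,2) T psi_sq[of "- int n"] by (simp add: cre_def psi_scale psi_total)
    then show ?thesis using 2 by (simp add: S(2)) (simp add: xi_mult_basis)
  next
    case 3
    let ?x = "ext_mult (xi n) (basis S)"
    \<comment> \<open>As \<open>n > k\<close>, multiplication by \<open>xi n\<close> keeps every
      index above \<open>k\<close>.\<close>
    have x: "?x \<in> basis_span {S \<in> ext_window J. \<forall>i. i |\<in>| S \<longrightarrow> k < i}"
      using insert.hyps kS assms(2) 3
      by (auto simp: xi_mult_basis ext_window_def intro!: basis_span_scale)
    have "fock (ext_mult (xi n) (basis (finsert k S))) = - fock (ext_mult (xi k) ?x)"
      by (simp add: S xi_xi[of n k] fock_minus)
    also have "\<dots> = - cre k (cre n (monomial S))"
      using fock_xi_min[OF x kS(1)] insert.IH kS by simp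
    also have "\<dots> = cre n (cre k (monomial S))"
      using cre_anticomm[of k n "monomial S"] kS assms(2) 3 T by simp
    finally show ?thesis by (simp add: S)
  qed
qed

text \<open>For \<open>n = k\<close> the central term is \<open>lam\<close>, divided by the
  \<open>\<mu>\<close> in \<open>cre\<close>, which leaves \<open>\<mu>\<close>.\<close>

lemma psi_cre:
  assumes "n > 0" "n \<in> J" "k \<in> J" "v \<in> total_space V"
  shows "act (psi (int n)) (cre k v) = (if n = k then scale \<mu> v else 0) - cre k (act (psi (int n)) v)"
  using psi_anticomm[of "int n" "- int k" v] assms mu_nonzero
  by (auto simp: cre_def psi_scale psi_total M.scale_right_diff_distrib power2_eq_square simp flip: mu_sq)

text \<open>Both sides satisfy the same recursion, \<open>psi_cre\<close> on the left and
  \<open>deriv_xi\<close> on the right, and both vanish on the empty monomial.\<close>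

lemma psi_monomial:
  assumes "n > 0" "n \<in> J" "S \<in> ext_window J"
  shows "act (psi (int n)) (monomial S) = scale \<mu> (fock (ext_deriv n (basis S)))"
  using assms(3)
proof (induction S rule: fset_linorder_min_induct)
  case empty
  show ?case using assms(1,2) vacuum_annihilated by (simp add: ext_deriv_one)
next
  case (insert k S)
  then have kS: "k \<in> J" "S \<in> ext_window J" "k |\<notin>| S" by (auto simp: ext_window_def)
  have S: "basis (finsert k S) = ext_mult (xi k) (basis S)" "monomial (finsert k S) = cre k (monomial S)"
    using insert.hyps by (auto intro: basis_eq_xi_mult monomial_finsert)
  let ?x = "ext_deriv n (basis S)"
  have x: "?x \<in> basis_span {S \<in> ext_window J. \<forall>i. i |\<in>| S \<longrightarrow> k < i}"
    using insert.hyps kS by (auto simp: ext_deriv_basis ext_window_def intro!: basis_span_scale)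
  then have "?x \<in> basis_span (ext_window J)"
    using basis_span_mono[of "{S \<in> ext_window J. \<forall>i. i |\<in>| S \<longrightarrow> k < i}" "ext_window J"] by auto
  then have xT: "fock ?x \<in> total_space V" by (rule fock_total)
  have "act (psi (int n)) (monomial (finsert k S)) =
      (if n = k then scale \<mu> (monomial S) else 0) - scale \<mu> (cre k (fock ?x))"
    using psi_cre[of n k "monomial S"] assms(1,2) kS monomial_total insert.IH xT
    by (simp add: S cre_linear)
  also have "\<dots> = scale \<mu> (fock (ext_deriv n (basis (finsert k S))))"
    using fock_xi_min[OF x kS(1)]
    by (auto simp: S deriv_xi fock_minus M.scale_right_diff_distrib)
  finally show ?case .
qed

lemma psi_zero_monomial:
  assumes "S \<in> ext_window J"
  shows "act (psi 0) (monomial S) = scale \<mu> (fock (ext_basis_act (Psi 0) (basis S)))"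
proof (cases "0 |\<in>| S")
  case False
  then have S: "monomial (finsert 0 S) = cre 0 (monomial S)"
    "ext_mult (xi 0) (basis S) = basis (finsert 0 S)"
    by (auto intro!: monomial_finsert basis_eq_xi_mult[symmetric]) (metis gr0I)+
  \<comment> \<open>Without index 0 the derivation contributes nothing, and the factor
    \<open>sqrt 2 / \<mu>\<close> in \<open>cre 0\<close> inverts the coefficient
    \<open>\<mu> / sqrt 2\<close> of \<open>xi 0\<close>.\<close>
  show ?thesis using False mu_nonzero
    by (simp add: S ext_deriv_basis fock_scale cre_def)
next
  case True
  define T where "T = S |-| {|0|}"
  have T: "S = finsert 0 T" "\<And>i. i |\<in>| T \<Longrightarrow> 0 < i" "T \<in> ext_window J"
    using True assms by (auto simp: T_def ext_window_def)
  then have "0 |\<notin>| T" by blast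
  then have S: "monomial S = cre 0 (monomial T)" "ext_mult (xi 0) (basis S) = 0" "ext_deriv 0 (basis S) = basis T"
    using T by (auto simp: monomial_finsert basis_eq_xi_mult deriv_xi ext_deriv_basis simp flip: ext_mult_assoc)
      (simp add: xi_square)
  \<comment> \<open>The left side comes from \<open>cre 0\<close> followed by the square of
    \<open>psi 0\<close>; the right side is the twisted coefficient of the derivation.\<close>
  have mu: "complex_of_real (sqrt 2) / \<mu> * (lam / 2) = \<mu> * (1 / complex_of_real (sqrt 2))"
  proof -
    have "complex_of_real (sqrt 2) * complex_of_real (sqrt 2) = 2" by (simp flip: of_real_mult)
    then show ?thesis using mu_nonzero mu_sq
      by (simp add: field_simps power2_eq_square)
  qed
  have "act (psi 0) (monomial S) = scale (complex_of_real (sqrt 2) / \<mu> * (lam / 2)) (monomial T)"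
    using psi_zero_sq[of "monomial T"] monomial_total[OF T(3)] zero_window
    by (simp add: S cre_def psi_scale psi_total)
  then show ?thesis unfolding mu by (simp add: S fock_scale)
qed

lemma psi_fock:
  assumes "nat \<bar>n\<bar> \<in> J" "x \<in> basis_span (ext_window J)"
  shows "act (psi n) (fock x) = scale \<mu> (fock (ext_basis_act (Psi n) x))"
proof -
  have "fock x \<in> total_space V \<and> act (psi n) (fock x) = scale \<mu> (fock (ext_basis_act (Psi n) x))"
    using assms(2)
  proof (induction rule: basis_span_induct)
    case zero
    have "ext_basis_act (Psi n) 0 = 0" using ext_basis_act_linear(2)[of "Psi n" 0 0] by simp
    then show ?case
      using psi_zero_right[OF assms(1)] M.subspace_0[OF total_subspace] by (simp del: ext_basis_act.simps)
  next
    case (add x y)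
    then show ?case using assms(1)
      by (simp add: ext_basis_act_linear fock_add psi_add M.scale_right_distrib M.subspace_add[OF total_subspace]
        del: ext_basis_act.simps)
  next
    case (scale c x)
    then show ?case using assms(1)
      by (simp add: ext_basis_act_linear fock_scale psi_scale M.subspace_scale[OF total_subspace] mult.commute
        del: ext_basis_act.simps)
  next
    case (basis S)
    consider "n > 0" | "n = 0" | "n < 0" by linarith
    then have "act (psi n) (monomial S) = scale \<mu> (fock (ext_basis_act (Psi n) (basis S)))"
    proof cases
      case 1
      then show ?thesis using psi_monomial[of "nat n" S] basis assms(1) by simp
    next
      case 2
      then show ?thesis using psi_zero_monomial[of S] basis by (simp del: ext_basis_act.simps)
    next
      case 3
      then show ?thesis using fock_xi_basis[of "nat (- n)" S] basis assms(1) mu_nonzero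
        by (simp add: cre_def)
    qed
    then show ?case using basis monomial_total by (simp del: ext_basis_act.simps)
  qed
  then show ?thesis ..
qed

text \<open>On generators the twist supplies the factor \<open>\<mu>\<close> of
  \<open>psi_fock\<close>, and on \<open>fermion_z\<close> the factor
  \<open>\<mu>\<^sup>2 = lam\<close>; linearity does the rest.\<close>

lemma act_fock:
  assumes "y \<in> basis_span (fermion_window J)" "x \<in> basis_span (ext_window J)"
  shows "act y (fock x) = fock (twist \<mu> ext_act y x)"
  unfolding twist_def
proof -
  have T: "fock x \<in> total_space V" using fock_total assms(2) by blast
  have "y \<in> basis_span (fermion_window J) \<and> act y (fock x) = fock (ext_act (fermion_sigma \<mu> y) x)"
    using assms(1)
  proof (induction rule: basis_span_induct)
    case zero
    then show ?case using act_scale_left[of 0 "fock x" 0] T by (simp add: total_window)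
  next
    case (add y y')
    then show ?case using act_add_left[of y y' "fock x"] T
      by (simp add: total_window basis_span_add fermion_sigma_linear ext_act_linear fock_add)
  next
    case (scale c y)
    then show ?case using act_scale_left[of y "fock x" c] T
      by (simp add: total_window basis_span_scale fermion_sigma_linear ext_act_linear fock_scale)
  next
    case (basis b)
    then show ?case
    proof (cases b)
      case (Psi n)
      then show ?thesis using basis psi_fock[of n x] assms(2)
        by (simp add: ext_act_linear ext_act_basis fock_scale del: ext_basis_act.simps)
    next
      case Zc
      then show ?thesis using act_z[OF T]
        by (simp add: ext_act_linear ext_act_basis fock_scale mu_sq)
    qed
  qed
  then show "act y (fock x) = fock (ext_act (fermion_sigma \<mu> y) x)" ..
qed

section \<open>Injectivity of the Fock map\<close>

text \<open>Each creation step can be undone. For \<open>k = 0\<close>, \<open>psi 0\<close> is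
  invertible; for \<open>k > 0\<close>, mode \<open>k\<close> kills the monomial without
  \<open>k\<close>, so annihilating after creating multiplies it by a nonzero scalar.\<close>

lemma monomial_nonzero: "S \<in> ext_window J \<Longrightarrow> monomial S \<noteq> 0"
proof (induction S rule: fset_linorder_min_induct)
  case empty
  show ?case using vacuum_nonzero by simp
next
  case (insert k S)
  then have kS: "k \<in> J" "S \<in> ext_window J" "k |\<notin>| S" by (auto simp: ext_window_def)
  have T: "monomial S \<in> total_space V" using kS monomial_total by blast
  show ?case
  proof
    assume "monomial (finsert k S) = 0"
    then have "cre k (monomial S) = 0" using insert.hyps by (simp add: monomial_finsert)
    then have z: "act (psi (- int k)) (monomial S) = 0" using mu_nonzero by (auto simp: cre_def split: if_splits)
    have "monomial S = 0"
    proof (cases "k = 0")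
      case True
      then have "scale (lam / 2) (monomial S) = 0"
        using psi_zero_sq[OF T] z psi_zero_right[of 0] zero_window by simp
      then show ?thesis using lam_nonzero by simp
    next
      case False
      have "act (psi (int k)) (monomial S) = 0"
        using psi_monomial[of k S] False kS by (simp add: ext_deriv_basis)
      then have "scale lam (monomial S) = 0"
        using psi_anticomm[of "int k" "- int k" "monomial S"] z kS T psi_zero_right[of "int k"]
          psi_zero_right[of "- int k"] by simp
      then show ?thesis using lam_nonzero by simp
    qed
    then show False using insert.IH kS by blast
  qed
qed

text \<open>By intertwining, the kernel is stable under the exterior generators, hence under the
  number operator of mode \<open>n\<close>.\<close>

lemma kernel_number:
  assumes "x \<in> basis_span (ext_window J)" "fock x = 0" "n > 0" "n \<in> J"
  shows "fock (restrict_keys (\<lambda>S. n |\<in>| S) x) = 0"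
proof -
  have step: "fock (ext_basis_act (Psi k) y) = 0"
    if "y \<in> basis_span (ext_window J)" "fock y = 0" "nat \<bar>k\<bar> \<in> J" for k y
    using psi_fock[of k y] that psi_zero_right mu_nonzero by (simp del: ext_basis_act.simps)
  have "fock (ext_basis_act (Psi (- int n)) (ext_basis_act (Psi (int n)) x)) = 0"
    using assms by (intro step ext_basis_act_window) auto
  then show ?thesis using assms(3) by (simp add: xi_mult_deriv)
qed

text \<open>The images of the even and odd parts of \<open>x\<close> lie in independent subspaces
  and add up to zero.\<close>

lemma kernel_parity:
  assumes "x \<in> basis_span (ext_window J)" "fock x = 0"
  shows "fock (restrict_keys (\<lambda>S. ext_deg S = i) x) = 0"
proof -
  let ?r = "\<lambda>i. restrict_keys (\<lambda>S. ext_deg S = i) x"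
  have r: "fock (?r i) \<in> V i" for i
    using assms(1) by (intro fock_part) (auto simp: basis_span_def keys_restrict_keys)
  have "x = ?r 0 + ?r 1"
    by (rule poly_mapping_eqI) (auto simp: lookup_add lookup_restrict_keys)
  then have sum: "fock (?r 0) + fock (?r 1) = 0" using assms(2) by (metis fock_add)
  then have "fock (?r 0) = - fock (?r 1)" by (simp add: eq_neg_iff_add_eq_0)
  then have "fock (?r 0) \<in> V 0 \<inter> V 1"
    using r[of 0] r[of 1] M.subspace_neg[OF M.subspace_part] by simp
  then have "fock (?r 0) = 0" using M.parts_independent by blast
  then show ?thesis using sum by (cases i) auto
qed

text \<open>
  The kernel is stable under restriction to \<open>n \<in> S\<close> for \<open>n > 0\<close> and to even \<open>S\<close>.  These
  conditions separate monomials, so a kernel element of minimal support is a monomial.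
\<close>

lemma fock_injective:
  assumes "x \<in> basis_span (ext_window J)" "fock x = 0"
  shows "x = 0"
  using assms
proof (induction "card (Poly_Mapping.keys x)" arbitrary: x rule: less_induct)
  case less
  show ?case
  proof (rule ccontr)
    assume "x \<noteq> 0"
    then obtain S where S: "S \<in> Poly_Mapping.keys x" by fastforce
    have win: "T \<in> ext_window J" if "T \<in> Poly_Mapping.keys x" for T
      using less.prems(1) that by (auto simp: basis_span_def)
    \<comment> \<open>Otherwise the restriction to \<open>Q\<close> would be a nonzero kernel
      element with strictly smaller support.\<close>
    have no_split: "Q T \<longleftrightarrow> Q U"
      if "fock (restrict_keys Q x) = 0" and TU: "T \<in> Poly_Mapping.keys x" "U \<in> Poly_Mapping.keys x" for Q T U
    proof (rule ccontr)
      assume "Q T \<noteq> Q U"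
      then have "Poly_Mapping.keys (restrict_keys Q x) \<subset> Poly_Mapping.keys x"
        and ne: "Poly_Mapping.keys (restrict_keys Q x) \<noteq> {}"
        using TU by (auto simp: keys_restrict_keys)
      then have "card (Poly_Mapping.keys (restrict_keys Q x)) < card (Poly_Mapping.keys x)"
        by (intro psubset_card_mono) auto
      moreover have "restrict_keys Q x \<in> basis_span (ext_window J)"
        using less.prems(1) by (auto simp: basis_span_def keys_restrict_keys)
      ultimately have "restrict_keys Q x = 0" using less.hyps that(1) by blast
      then show False using ne by simp
    qed
    have "T = S" if T: "T \<in> Poly_Mapping.keys x" for T
    proof -
      have pos: "n |\<in>| S \<longleftrightarrow> n |\<in>| T" if "n > 0" for n
      proof (cases "n \<in> J")
        case True
        then show ?thesis using no_split kernel_number[OF less.prems that] S T by blast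
      next
        case False
        then show ?thesis using win S T by (auto simp: ext_window_def)
      qed
      \<comment> \<open>The positive indices leave open only whether 0 belongs to the set; parity
        decides this.\<close>
      have deg: "ext_deg S = ext_deg T"
        using no_split[OF kernel_parity[OF less.prems, of "ext_deg S"] S T] by simp
      have ne: "ext_deg A \<noteq> ext_deg B"
        if "0 |\<in>| A" "0 |\<notin>| B" "\<And>n. n > 0 \<Longrightarrow> n |\<in>| A \<longleftrightarrow> n |\<in>| B" for A B
      proof -
        have "A = finsert 0 B" using that by (metis finsert_iff fset_eqI gr0I)
        then show ?thesis using ext_deg_finsert[OF that(2)] by simp
      qed
      have "0 |\<in>| S \<longleftrightarrow> 0 |\<in>| T" using ne[of S T] ne[of T S] deg pos by metis
      then show "T = S" using pos by (metis fset_eqI gr0I)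
    qed
    then have "Poly_Mapping.keys x = {S}" using S by blast
    then have "fock x = scale (Poly_Mapping.lookup x S) (monomial S)"
      by (simp add: fock_def)
    then show False
      using less.prems(2) S monomial_nonzero[OF win[OF S]] by (simp add: in_keys_iff)
  qed
qed

section \<open>Surjectivity and the isomorphism\<close>

text \<open>The image is a graded submodule containing the nonzero vacuum, so simplicity
  applies.\<close>

lemma fock_surjective: "fock ` basis_span (ext_window J) = total_space V"
proof -
  let ?W = "fock ` basis_span (ext_window J)"
  have sub: "M.subspace ?W"
    unfolding M.subspace_def
  proof (intro conjI ballI allI)
    show "0 \<in> ?W" by (rule image_eqI[of _ _ 0]) simp_all
  next
    fix a b assume "a \<in> ?W" "b \<in> ?W"
    then show "a + b \<in> ?W" by (auto simp flip: fock_add intro: basis_span_add)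
  next
    fix c a assume "a \<in> ?W"
    then show "scale c a \<in> ?W" by (auto simp flip: fock_scale intro: basis_span_scale)
  qed
  have "?W = total_space (\<lambda>i. ?W \<inter> V i)"
  proof (intro equalityI subsetI)
    fix v assume "v \<in> ?W"
    then obtain x where x: "x \<in> basis_span (ext_window J)" "v = fock x" by blast
    then obtain a b where ab: "a \<in> basis_span {S \<in> ext_window J. ext_deg S = 0}"
      "b \<in> basis_span {S \<in> ext_window J. ext_deg S = 1}" "x = a + b"
      unfolding total_space_basis_span[of "ext_window J" ext_deg, symmetric] total_space_def by blast
    then have "fock a \<in> ?W \<inter> V 0" "fock b \<in> ?W \<inter> V 1"
      using fock_part by (auto intro!: imageI simp: basis_span_def)
    then show "v \<in> total_space (\<lambda>i. ?W \<inter> V i)"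
      using x ab fock_add by (auto simp: total_space_def)
  next
    fix v assume "v \<in> total_space (\<lambda>i. ?W \<inter> V i)"
    then show "v \<in> ?W" using M.subspace_add[OF sub] by (auto simp only: total_space_def)
  qed
  moreover have "act y v \<in> ?W" if "y \<in> basis_span (fermion_window J)" "v \<in> ?W" for y v
    using that act_fock ext_act_window fermion_sigma_mem by (auto simp: twist_def)
  ultimately have "graded_submodule ?W"
    using sub by (simp add: graded_submodule_def total_window)
  moreover have "w \<in> ?W"
    by (rule image_eqI[of _ _ ext_one]) (simp_all add: ext_window_def)
  ultimately show ?thesis using simple vacuum_nonzero by blast
qed

text \<open>The isomorphism is required to start from the given module, so the witness is the
  inverse of \<open>fock\<close>.\<close>

lemma isomorphic_twist:
  "supermodule_isomorphic (\<lambda>i. basis_span {b \<in> fermion_window J. fermion_deg b = i}) scale V act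
    pscale (\<lambda>i. basis_span {S \<in> ext_window J. ext_deg S = i}) (twist \<mu> ext_act)"
proof -
  let ?E = "basis_span (ext_window J)"
  let ?g = "inv_into ?E fock"
  have inj: "inj_on fock ?E"
  proof (rule inj_onI)
    fix x y assume xy: "x \<in> ?E" "y \<in> ?E" "fock x = fock y"
    then have "x - y \<in> ?E" by (intro pm.subspace_diff[OF subspace_basis_span])
    then show "x = y" using fock_injective[of "x - y"] xy(3) by (simp add: fock_minus)
  qed
  have g: "?g v \<in> ?E" "fock (?g v) = v" if "v \<in> total_space V" for v
    using that by (simp_all add: inv_into_into f_inv_into_f fock_surjective)
  \<comment> \<open>Reduces every identity for the inverse to one for \<open>fock\<close>.\<close>
  have eq: "?g v = x" if "x \<in> ?E" "fock x = v" for x v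
    using that inj by auto
  \<comment> \<open>The component of \<open>?g v\<close> of the wrong parity is mapped into both
    parts of the module, hence to 0, and vanishes by injectivity.\<close>
  have part: "?g v \<in> basis_span {S \<in> ext_window J. ext_deg S = i}" if v: "v \<in> V i" for i v
  proof -
    let ?x = "?g v"
    have x: "?x \<in> ?E" "fock ?x = v" using g part_total v by auto
    let ?r = "\<lambda>i. restrict_keys (\<lambda>S. ext_deg S = i) ?x"
    have rE: "?r j \<in> ?E" "fock (?r j) \<in> V j" for j
      using x(1) by (auto simp: basis_span_def keys_restrict_keys intro!: fock_part)
    have "?x = ?r i + ?r (i + 1)"
      by (rule poly_mapping_eqI) (cases i; auto simp: lookup_add lookup_restrict_keys)
    then have sum: "?x - ?r i = ?r (i + 1)" by (simp add: algebra_simps)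
    then have "fock (?r (i + 1)) = v - fock (?r i)" using x(2) by (metis fock_minus(2))
    then have "fock (?r (i + 1)) \<in> V i"
      using M.subspace_diff[OF M.subspace_part v rE(2)] by (simp only:)
    with rE(2) have "fock (?r (i + 1)) \<in> V i \<inter> V (i + 1)" by blast
    then have "fock (?r (i + 1)) = 0" using M.parts_independent by (cases i) auto
    then have "?r (i + 1) = 0" using fock_injective rE by blast
    then have "?x = ?r i" using sum by simp
    moreover have "?r i \<in> basis_span {S \<in> ext_window J. ext_deg S = i}"
      using x(1) by (auto simp: basis_span_def keys_restrict_keys)
    ultimately show ?thesis by metis
  qed
  show ?thesis
    unfolding supermodule_isomorphic_def total_space_basis_span
  proof (intro exI[of _ ?g] conjI ballI allI)
    show "bij_betw ?g (total_space V) ?E"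
      using bij_betw_inv_into[of fock ?E "total_space V"] inj fock_surjective by (simp add: bij_betw_def)
  next
    fix v v' assume "v \<in> total_space V" "v' \<in> total_space V"
    then show "?g (v + v') = ?g v + ?g v'"
      by (intro eq) (simp_all add: g fock_add basis_span_add)
  next
    fix c v assume "v \<in> total_space V"
    then show "?g (scale c v) = pscale c (?g v)"
      by (intro eq) (simp_all add: g fock_scale basis_span_scale)
  next
    fix i show "?g ` V i \<subseteq> basis_span {S \<in> ext_window J. ext_deg S = i}" using part by blast
  next
    fix y v assume yv: "y \<in> basis_span (fermion_window J)" "v \<in> total_space V"
    show "?g (act y v) = twist \<mu> ext_act y (?g v)"
    proof (rule eq)
      show "twist \<mu> ext_act y (?g v) \<in> ?E"
        using yv g by (simp add: twist_def ext_act_window fermion_sigma_mem)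
      show "fock (twist \<mu> ext_act y (?g v)) = act y v"
        using act_fock[of y "?g v"] yv g by simp
    qed
  qed
qed

end

section \<open>Specialisation to the truncated and the full algebra\<close>

text \<open>The vacuum is found without reference to \<open>\<mu>\<close>, so each square root of
  \<open>lam\<close> gives an isomorphism.\<close>

lemma (in simple_fermion_module) isomorphic_twist_sqrt:
  assumes "\<mu>\<^sup>2 = lam"
  shows "supermodule_isomorphic (\<lambda>i. basis_span {b \<in> fermion_window J. fermion_deg b = i}) scale V act
    pscale (\<lambda>i. basis_span {S \<in> ext_window J. ext_deg S = i}) (twist \<mu> ext_act)"
proof -
  obtain w where "w \<in> V 0" "w \<noteq> 0" "\<And>n. n > 0 \<Longrightarrow> n \<in> J \<Longrightarrow> act (psi (int n)) w = 0"
    using even_vacuum by blast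
  then interpret fermion_vacuum J scale V act lam w \<mu>
    using assms by unfold_locales
  show ?thesis by (rule isomorphic_twist)
qed

lemma fermion_trunc_part_window:
  "fermion_trunc_part m = (\<lambda>i. basis_span {b \<in> fermion_window {..m}. fermion_deg b = i})"
proof -
  have "{n. nat \<bar>n\<bar> \<in> {..m}} = {- int m..int m}" by auto
  then show ?thesis by (simp add: fermion_trunc_part_def[abs_def] fermion_window_def)
qed

lemma fermion_part_window:
  "fermion_part = (\<lambda>i. basis_span {b \<in> fermion_window UNIV. fermion_deg b = i})"
proof -
  have "b \<in> fermion_window UNIV" for b by (cases b) simp_all
  then show ?thesis by (simp add: fermion_part_def[abs_def])
qed

lemma ext_trunc_part_window:
  "ext_trunc_part m = (\<lambda>i. basis_span {S \<in> ext_window {..m}. ext_deg S = i})"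
  by (simp add: ext_trunc_part_def[abs_def] ext_window_def)

lemma ext_part_window: "ext_part = (\<lambda>i. basis_span {S \<in> ext_window UNIV. ext_deg S = i})"
  by (simp add: ext_part_def[abs_def] ext_window_def)

theorem lemma3p6:
  fixes scale :: "complex \<Rightarrow> 'v::ab_group_add \<Rightarrow> 'v"
    and V :: "bit \<Rightarrow> 'v set"
    and act :: "fermion \<Rightarrow> 'v \<Rightarrow> 'v"
    and lam :: complex
    and m :: nat
  assumes "lam \<noteq> 0"
    and "\<forall>v\<in>total_space V. act fermion_z v = scale lam v"
  shows "(simple_lie_supermodule pscale (fermion_trunc_part m) fermion_br scale V act \<longrightarrow>
      (\<exists>\<mu>. \<mu>\<^sup>2 = lam \<and>
        supermodule_isomorphic (fermion_trunc_part m) scale V act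
          pscale (ext_trunc_part m) (twist \<mu> ext_act)))
    \<and> (simple_lie_supermodule pscale fermion_part fermion_br scale V act \<and> smooth_module V act \<longrightarrow>
      (\<exists>\<mu>. \<mu>\<^sup>2 = lam \<and>
        supermodule_isomorphic fermion_part scale V act
          pscale ext_part (twist \<mu> ext_act)))"
proof (intro conjI impI)
  obtain \<mu> where mu: "\<mu>\<^sup>2 = lam" using power2_csqrt by blast
  {
    assume "simple_lie_supermodule pscale (fermion_trunc_part m) fermion_br scale V act"
    then interpret simple_lie_supermodule pscale "\<lambda>i. basis_span {b \<in> fermion_window {..m}. fermion_deg b = i}"
      fermion_br scale V act
      unfolding fermion_trunc_part_window .
    interpret simple_fermion_module "{..m}" scale V act lam
      \<comment> \<open>With \<open>N = m\<close> the annihilation condition is vacuous: no mode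
        above \<open>m\<close> lies in the window.\<close>
      by unfold_locales (use assms in \<open>auto intro!: exI[of _ m]\<close>)
    show "\<exists>\<mu>. \<mu>\<^sup>2 = lam \<and> supermodule_isomorphic (fermion_trunc_part m) scale V act
        pscale (ext_trunc_part m) (twist \<mu> ext_act)"
      using isomorphic_twist_sqrt mu unfolding fermion_trunc_part_window ext_trunc_part_window by blast
  next
    assume *: "simple_lie_supermodule pscale fermion_part fermion_br scale V act \<and> smooth_module V act"
    then interpret simple_lie_supermodule pscale "\<lambda>i. basis_span {b \<in> fermion_window UNIV. fermion_deg b = i}"
      fermion_br scale V act
      unfolding fermion_part_window by blast
    interpret simple_fermion_module UNIV scale V act lam
    proof unfold_locales
      fix v assume "v \<in> total_space V"
      \<comment> \<open>Smoothness is exactly what supplies the bound for the infinite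
        window.\<close>
      then show "\<exists>N::nat. \<forall>n>N. n \<in> UNIV \<longrightarrow> act (psi (int n)) v = 0"
        using * unfolding smooth_module_def by (metis of_nat_less_iff)
    qed (use assms in auto)
    show "\<exists>\<mu>. \<mu>\<^sup>2 = lam \<and> supermodule_isomorphic fermion_part scale V act
        pscale ext_part (twist \<mu> ext_act)"
      using isomorphic_twist_sqrt mu unfolding fermion_part_window ext_part_window by blast
  }
qed

end
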